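(* Let $f:\subseteq\mathbf U\rightrightarrows\mathbf V$ and $g:\subseteq\mathbf X\rightrightarrows\mathbf Y$ be multi-valued functions on represented spaces. Then $$(g\rightarrow f)\equiv_{\mathrm W}\min_{\leq_{\mathrm W}}\{h : f\leq_{\mathrm W}g\star h\},$$ where $h$ ranges over all multi-valued functions on represented spaces together with the top element $\infty$ (so the set always contains $\infty$). That is, the minimum exists and $(g\rightarrow f)$ is Weihrauch equivalent to it.
   Context: A represented space $\mathbf X=(X,\delta_X)$ is a set $X$ with a partial surjection $\delta_X:\subseteq\mathbb N^{\mathbb N}\to X$ (the symbol $\subseteq$ marks possibly partial functions). A multi-valued function $f:\subseteq\mathbf X\rightrightarrows\mathbf Y$ assigns to each $x\in\mathrm{dom}(f)\subseteq X$ a nonempty set $f(x)\subseteq Y$. Composition: $z\in(f\circ g)(x)$ iff $g(x)\subseteq\mathrm{dom}(f)$ and $z\in f(y)$ for some $y\in g(x)$ (with $x\in\mathrm{dom}(g)$). A function $F:\subseteq\mathbb N^{\mathbb N}\to\mathbb N^{\mathbb N}$ is a realizer of $f$, written $F\vdash f$, if $\delta_YF(p)\in f\delta_X(p)$ for all $p\in\mathrm{dom}(f\delta_X)$. $f\leq_{\mathrm W}g$ iff there are computable $K,H:\subseteq\mathbb N^{\mathbb N}\to\mathbb N^{\mathbb N}$ such that $K\langle\mathrm{id},GH\rangle\vdash f$ for all $G\vdash g$; $\equiv_{\mathrm W}$ is the induced equivalence. Products $\mathbf X\times\mathbf Y$ are represented via pairing $\langle\cdot,\cdot\rangle$, and $(f\times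 g)(x,u)=f(x)\times g(u)$. The preorder $\leq_{\mathrm W}$ is extended by an additional top element $\infty$ (the Axiom of Choice for Baire space is assumed). Space $\mathcal M(\mathbf X,\mathbf Y)$: fix a universal Turing machine; $\Phi_p:\subseteq\mathbb N^{\mathbb N}\to\mathbb N^{\mathbb N}$ is defined by $\Phi_p(q)=r$ iff on input $\langle p,q\rangle$ the machine writes infinitely often on the output tape, producing $r$. Let $\delta_X^{\mathrm{cyl}}\langle p,q\rangle:=\delta_X(p)$ and $\Phi_p^{\mathbf X,\mathbf Y}:=\delta_Y\circ\Phi_p\circ(\delta_X^{\mathrm{cyl}})^{-1}:\subseteq\mathbf X\rightrightarrows\mathbf Y$. $\mathcal M(\mathbf X,\mathbf Y)$ is the represented space of all $\Phi_p^{\mathbf X,\mathbf Y}$ (strongly continuous multi-valued functions), $p$ being a name of $\Phi_p^{\mathbf X,\mathbf Y}$. Compositional product: for $g:\subseteq\mathbf X\rightrightarrows\mathbf Y$ and a represented space $\mathbf Z$ let $g^{\mathrm t}_{\mathbf Z}:\subseteq\mathcal M(\mathbf Y,\mathbf Z)\times\mathbf X\rightrightarrows\mathbf Z$, $g^{\mathrm t}_{\mathbf Z}(k,x):=(k\circ g)(x)$; for $f:\subseteq\mathbf U\rightrightarrows\mathbf V$ put $f\star g:=(\mathrm{id}_{\mathbb N^{\mathbb N}}\times f)\circ g^{\mathrm t}_{\mathbb N^{\mathbb N}\times\mathbf U}$. Moreover $f\star\infty=\infty\star f=\infty$. Implication: for $f:\subseteq\mathbf U\rightrightarrows\mathbf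 V$ and $g:\subseteq\mathbf X\rightrightarrows\mathbf Y$ with $\mathrm{dom}(g)\neq\emptyset$ or $\mathrm{dom}(f)=\emptyset$, $(g\rightarrow f):\subseteq\mathbf U\rightrightarrows\mathcal M(\mathbf Y,\mathbf V)\times\mathbf X$ has $\mathrm{dom}(g\rightarrow f)=\mathrm{dom}(f)$, and $(H,x)\in(g\rightarrow f)(u)$ iff $(H\circ g)(x)\subseteq f(u)$ (where $x\in\mathrm{dom}(H\circ g)$). If $\mathrm{dom}(g)=\emptyset$ and $\mathrm{dom}(f)\neq\emptyset$, then $(g\rightarrow f):=\infty$. *)

theory Defs
  imports Complex_Main "HOL-Library.Sublist"
begin

section \<open>Turing machines on Baire space\<close>

type_synonym baire = "nat \<Rightarrow> nat"

text \<open>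
  Machines are multi-tape Turing machines given as flowcharts: a finite list of labelled
  instructions, the label of an instruction being its position in the list; a jump outside
  the list halts. A machine has one-way read-only heads on the (infinite) input tape, two-way
  infinite work tapes over the alphabet blank, 0, 1, and a one-way write-only output tape
  over 0, 1. Only the finitely many heads and tapes named in the program are ever used;
  allowing several input heads does not change the class of computable functions.

  \<^item> \<open>Read i l m\<close>: read the next input bit under input head \<open>i\<close>, advance that head,
    and go to \<open>l\<close> on 0 and to \<open>m\<close> on 1;
  \<^item> \<open>Write b l\<close>: append \<open>b\<close> to the output;
  \<^item> \<open>Test j l m n\<close>: branch on blank, 0, 1 under the head of work tape \<open>j\<close>.
\<close>

datatype instr =
    Read nat nat nat
  | Write bool nat
  | Move_Left nat nat
  | Move_Right nat nat
  | Put nat "bool option" nat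
  | Test nat nat nat nat

type_synonym machine = "instr list"

record config =
  pc :: nat
  in_pos :: "nat \<Rightarrow> nat"
  tape :: "nat \<Rightarrow> int \<Rightarrow> bool option"
  head_pos :: "nat \<Rightarrow> int"
  written :: "bool list"

text \<open>A sequence of numbers is written on a tape in unary: \<open>n\<close> is $1^n 0$.\<close>

definition unary :: "nat list \<Rightarrow> bool list" where
  "unary ns = concat (map (\<lambda>n. replicate n True @ [False]) ns)"

text \<open>The first \<open>Suc i\<close> numbers of \<open>p\<close> occupy at least \<open>Suc i\<close> cells.\<close>

definition input_bit :: "baire \<Rightarrow> nat \<Rightarrow> bool" where
  "input_bit p i = unary (map p [0..<Suc i]) ! i"

definition exec :: "baire \<Rightarrow> instr \<Rightarrow> config \<Rightarrow> config" where
  "exec p ins c = (case ins of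
      Read i l m \<Rightarrow> c\<lparr>pc := (if input_bit p (in_pos c i) then m else l),
                       in_pos := (in_pos c)(i := Suc (in_pos c i))\<rparr>
    | Write b l \<Rightarrow> c\<lparr>pc := l, written := written c @ [b]\<rparr>
    | Move_Left j l \<Rightarrow> c\<lparr>pc := l, head_pos := (head_pos c)(j := head_pos c j - 1)\<rparr>
    | Move_Right j l \<Rightarrow> c\<lparr>pc := l, head_pos := (head_pos c)(j := head_pos c j + 1)\<rparr>
    | Put j s l \<Rightarrow> c\<lparr>pc := l, tape := (tape c)(j := (tape c j)(head_pos c j := s))\<rparr>
    | Test j l m n \<Rightarrow> c\<lparr>pc := (case tape c j (head_pos c j) of
                            None \<Rightarrow> l | Some b \<Rightarrow> if b then n else m)\<rparr>)"

definition step :: "machine \<Rightarrow> baire \<Rightarrow> config \<Rightarrow> config" where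
  "step M p c = (if pc c < length M then exec p (M ! pc c) c else c)"

definition init_config :: config where
  "init_config = \<lparr>pc = 0, in_pos = (\<lambda>_. 0), tape = (\<lambda>_ _. None),
                  head_pos = (\<lambda>_. 0), written = []\<rparr>"

text \<open>On input \<open>p\<close> the machine keeps writing forever and its infinite output is the
  sequence \<open>r\<close>; such an \<open>r\<close> is unique.\<close>

definition produces :: "machine \<Rightarrow> baire \<Rightarrow> baire \<Rightarrow> bool" where
  "produces M p r \<longleftrightarrow>
     (\<forall>n. \<exists>t. prefix (unary (map r [0..<n])) (written ((step M p ^^ t) init_config)))"

definition machine_fun :: "machine \<Rightarrow> baire \<rightharpoonup> baire" where
  "machine_fun M p = (if \<exists>r. produces M p r then Some (THE r. produces M p r) else None)"

text \<open>As usual, nothing is required of the machine outside the domain of the function.\<close>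

definition computable :: "(baire \<rightharpoonup> baire) \<Rightarrow> bool" where
  "computable F \<longleftrightarrow> (\<exists>M. F \<subseteq>\<^sub>m machine_fun M)"

definition pair :: "baire \<Rightarrow> baire \<Rightarrow> baire" where
  "pair p q n = (if even n then p (n div 2) else q (n div 2))"

definition proj1 :: "baire \<Rightarrow> baire" where
  "proj1 r n = r (2 * n)"

definition proj2 :: "baire \<Rightarrow> baire" where
  "proj2 r n = r (2 * n + 1)"

text \<open>
  A universal machine simulates every machine \<open>M\<close>, also when part of the input of \<open>M\<close> is
  supplied together with the program: a program for \<open>q \<mapsto> M\<langle>p, q\<rangle>\<close> is computed from \<open>p\<close>.
  For the usual universal machines it is a code of \<open>M\<close> followed by \<open>p\<close>.
  (The parameter matters: if every machine just had some program, programs need not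
  form a reasonable representation of the strongly continuous functions.)
\<close>

definition universal :: "machine \<Rightarrow> bool" where
  "universal U \<longleftrightarrow> (\<forall>M. \<exists>s. computable (Some \<circ> s) \<and>
     (\<forall>p q. machine_fun U (pair (s p) q) = machine_fun M (pair p q)))"

definition Phi :: "machine \<Rightarrow> baire \<Rightarrow> baire \<rightharpoonup> baire" where
  "Phi U p q = machine_fun U (pair p q)"


section \<open>Represented spaces and multi-valued functions\<close>

text \<open>A represented space is given by its representation, a partial map on Baire space; as
  representations are surjective, the underlying set is the range. It may be any set of
  elements of the type \<open>'a\<close>, including the empty one.\<close>

type_synonym 'a rep = "baire \<rightharpoonup> 'a"

abbreviation points :: "'a rep \<Rightarrow> 'a set" where
  "points \<equiv> ran"

definition baire_rep :: "baire rep" where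
  "baire_rep = Some"

definition prod_rep :: "'a rep \<Rightarrow> 'b rep \<Rightarrow> ('a \<times> 'b) rep" where
  "prod_rep X Y r = (case (X (proj1 r), Y (proj2 r)) of
      (Some x, Some y) \<Rightarrow> Some (x, y) | _ \<Rightarrow> None)"

definition cyl :: "'a rep \<Rightarrow> 'a rep" where
  "cyl X r = X (proj1 r)"

text \<open>A multi-valued partial map is a set-valued function; being undefined at a point
  is having the empty set as value there.\<close>

definition mdom :: "('a \<Rightarrow> 'b set) \<Rightarrow> 'a set" where
  "mdom f = {x. f x \<noteq> {}}"

definition mcomp :: "('b \<Rightarrow> 'c set) \<Rightarrow> ('a \<Rightarrow> 'b set) \<Rightarrow> 'a \<Rightarrow> 'c set" where
  "mcomp f g x = {z. x \<in> mdom g \<and> g x \<subseteq> mdom f \<and> (\<exists>y\<in>g x. z \<in> f y)}"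

definition mtimes :: "('a \<Rightarrow> 'b set) \<Rightarrow> ('c \<Rightarrow> 'd set) \<Rightarrow> 'a \<times> 'c \<Rightarrow> ('b \<times> 'd) set" where
  "mtimes f g = (\<lambda>(x, u). f x \<times> g u)"

definition of_map :: "('a \<rightharpoonup> 'b) \<Rightarrow> 'a \<Rightarrow> 'b set" where
  "of_map F x = set_option (F x)"

definition minverse :: "('a \<rightharpoonup> 'b) \<Rightarrow> 'b \<Rightarrow> 'a set" where
  "minverse F y = {x. F x = Some y}"

record ('a, 'b) mvfun =
  source :: "'a rep"
  target :: "'b rep"
  val :: "'a \<Rightarrow> 'b set"

definition is_mvfun :: "('a, 'b) mvfun \<Rightarrow> bool" where
  "is_mvfun f \<longleftrightarrow> mdom (val f) \<subseteq> points (source f) \<and> (\<forall>x. val f x \<subseteq> points (target f))"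

definition times_mvfun ::
    "('a, 'b) mvfun \<Rightarrow> ('c, 'd) mvfun \<Rightarrow> ('a \<times> 'c, 'b \<times> 'd) mvfun" where
  "times_mvfun f g = \<lparr>source = prod_rep (source f) (source g),
                      target = prod_rep (target f) (target g),
                      val = mtimes (val f) (val g)\<rparr>"

text \<open>Meant for \<open>target g = source f\<close>.\<close>

definition comp_mvfun :: "('b, 'c) mvfun \<Rightarrow> ('a, 'b) mvfun \<Rightarrow> ('a, 'c) mvfun" where
  "comp_mvfun f g = \<lparr>source = source g, target = target f, val = mcomp (val f) (val g)\<rparr>"

definition id_baire :: "(baire, baire) mvfun" where
  "id_baire = \<lparr>source = baire_rep, target = baire_rep, val = (\<lambda>p. {p})\<rparr>"


section \<open>Weihrauch reducibility\<close>

definition realizes :: "(baire \<rightharpoonup> baire) \<Rightarrow> ('a, 'b) mvfun \<Rightarrow> bool" where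
  "realizes F f \<longleftrightarrow>
     (\<forall>p x. source f p = Some x \<longrightarrow> x \<in> mdom (val f) \<longrightarrow>
        (\<exists>y. (target f \<circ>\<^sub>m F) p = Some y \<and> y \<in> val f x))"

definition reducible :: "('a, 'b) mvfun \<Rightarrow> ('c, 'd) mvfun \<Rightarrow> bool" where
  "reducible f g \<longleftrightarrow> (\<exists>K H. computable K \<and> computable H \<and>
     (\<forall>G. realizes G g \<longrightarrow> realizes (K \<circ>\<^sub>m (\<lambda>p. map_option (pair p) ((G \<circ>\<^sub>m H) p))) f))"

datatype ('a, 'b) problem = MV "('a, 'b) mvfun" | Infty

fun is_problem :: "('a, 'b) problem \<Rightarrow> bool" where
  "is_problem (MV f) = is_mvfun f"
| "is_problem Infty = True"

fun weihrauch_le :: "('a, 'b) problem \<Rightarrow> ('c, 'd) problem \<Rightarrow> bool"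
    (infix \<open>\<le>\<^sub>W\<close> 50) where
  "MV f \<le>\<^sub>W MV g = reducible f g"
| "a \<le>\<^sub>W Infty = True"
| "Infty \<le>\<^sub>W MV g = False"


section \<open>Compositional product and implication\<close>

definition Phi_mv :: "machine \<Rightarrow> 'a rep \<Rightarrow> 'b rep \<Rightarrow> baire \<Rightarrow> 'a \<Rightarrow> 'b set" where
  "Phi_mv U X Y p = mcomp (of_map Y) (mcomp (of_map (Phi U p)) (minverse (cyl X)))"

definition mspace :: "machine \<Rightarrow> 'a rep \<Rightarrow> 'b rep \<Rightarrow> ('a \<Rightarrow> 'b set) rep" where
  "mspace U X Y p = Some (Phi_mv U X Y p)"

definition transposed ::
    "machine \<Rightarrow> 'c rep \<Rightarrow> ('a, 'b) mvfun \<Rightarrow> (('b \<Rightarrow> 'c set) \<times> 'a, 'c) mvfun" where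
  "transposed U Z g =
     \<lparr>source = prod_rep (mspace U (target g) Z) (source g),
      target = Z,
      val = (\<lambda>(k, x). {z. k \<in> points (mspace U (target g) Z) \<and> z \<in> mcomp k (val g) x})\<rparr>"

fun comp_product :: "machine \<Rightarrow> ('u, 'v) problem \<Rightarrow> ('x, 'y) problem \<Rightarrow>
    (('y \<Rightarrow> (baire \<times> 'u) set) \<times> 'x, baire \<times> 'v) problem" where
  "comp_product U (MV f) (MV g) =
     MV (comp_mvfun (times_mvfun id_baire f) (transposed U (prod_rep baire_rep (source f)) g))"
| "comp_product U a Infty = Infty"
| "comp_product U Infty (MV g) = Infty"

text \<open>\<open>implication U g f\<close> is \<open>g \<rightarrow> f\<close>.\<close>

definition implication :: "machine \<Rightarrow> ('x, 'y) mvfun \<Rightarrow> ('u, 'v) mvfun \<Rightarrow>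
    ('u, ('y \<Rightarrow> 'v set) \<times> 'x) problem" where
  "implication U g f =
     (if mdom (val g) \<noteq> {} \<or> mdom (val f) = {} then
        MV \<lparr>source = source f,
            target = prod_rep (mspace U (target g) (target f)) (source g),
            val = (\<lambda>u. {(H, x). u \<in> mdom (val f) \<and> H \<in> points (mspace U (target g) (target f)) \<and>
                       x \<in> mdom (mcomp H (val g)) \<and> mcomp H (val g) x \<subseteq> val f u})\<rparr>
      else Infty)"

end

theory Submission
  imports Defs "HOL-Library.Nat_Bijection"
begin

text \<open>
  To reduce \<open>f\<close> to \<open>g \<star> (g \<rightarrow> f)\<close>, pair a name of \<open>u\<close> with a program
  that turns a name of an answer \<open>(H, x)\<close> of \<open>g \<rightarrow> f\<close> into a program \<open>t\<close> for \<open>H\<close> and the point \<open>x\<close>; then \<open>g\<close>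
  is applied to \<open>x\<close>, and finally \<open>t\<close> is run on the result.
  Conversely, let \<open>K\<close> and \<open>H\<close> reduce \<open>f\<close> to \<open>g \<star> h\<close>. On a name \<open>p\<close> of \<open>u\<close>, \<open>H\<close> yields a program \<open>k\<close>
  and an input for \<open>h\<close>; running \<open>k\<close> on the answer of \<open>h\<close> gives some \<open>t\<close> and a point \<open>x\<close>. Now \<open>x\<close> and
  a program for \<open>q \<mapsto> K \<langle>p, \<langle>t, q\<rangle>\<rangle>\<close> are an answer of \<open>g \<rightarrow> f\<close> at \<open>u\<close>.
  All this needs that computable functions are closed under composition and pairing. The
  machines for these run others as coroutines that are interrupted whenever they write a bit,
  so that no intermediate output is stored.
\<close>

section \<open>Sequences as streams of bits\<close>

text \<open>A sequence stands for the bit stream that encodes it on a tape; \<open>rest r\<close> is the sequence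
  encoded by the stream of \<open>r\<close> without its first bit.\<close>

definition first_bit :: "baire \<Rightarrow> bool" where
  "first_bit r \<longleftrightarrow> 0 < r 0"

definition rest :: "baire \<Rightarrow> baire" where
  "rest r = (if first_bit r then r(0 := r 0 - 1) else (\<lambda>n. r (Suc n)))"

definition bits :: "baire \<Rightarrow> nat \<Rightarrow> bool list" where
  "bits r n = map (\<lambda>i. first_bit ((rest ^^ i) r)) [0..<n]"

lemma length_bits [simp]: "length (bits r n) = n"
  by (simp add: bits_def)

lemma bits_0 [simp]: "bits r 0 = []"
  by (simp add: bits_def)

lemma bits_Suc: "bits r (Suc n) = bits r n @ [first_bit ((rest ^^ n) r)]"
  by (simp add: bits_def)

lemma prefix_bits: "m \<le> n \<Longrightarrow> prefix (bits r m) (bits r n)"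
  by (induction n) (auto simp: bits_Suc le_Suc_eq)

text \<open>Dropping a leading 1 only decrements the first number, so all \<open>Suc n\<close>
  entries stay; dropping a leading 0 removes a finished entry, so one fewer remains.\<close>

lemma unary_upt_Suc:
  "unary (map r [0..<Suc n]) =
     first_bit r # unary (map (rest r) [0..<(if first_bit r then Suc n else n)])"
proof (cases "r 0")
  case 0
  then show ?thesis
    by (simp add: upt_conv_Cons unary_def first_bit_def rest_def map_Suc_upt[symmetric] o_def
             del: upt_Suc)
next
  case (Suc m)
  have "map r [1..<Suc n] = map (r(0 := m)) [1..<Suc n]"
    by (rule map_cong) auto
  with Suc show ?thesis
    by (simp add: upt_conv_Cons unary_def first_bit_def rest_def del: upt_Suc)
qed

lemma nth_unary:
  "i < length (unary (map r [0..<n])) \<Longrightarrow>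
     unary (map r [0..<n]) ! i = first_bit ((rest ^^ i) r)"
proof (induction i arbitrary: r n)
  case 0
  then show ?case
    by (cases n) (simp_all add: unary_def[of "[]"] unary_upt_Suc del: upt_Suc)
next
  case (Suc i)
  then show ?case
    by (cases n) (simp_all add: unary_def[of "[]"] unary_upt_Suc funpow_Suc_right del: upt_Suc funpow.simps)
qed

lemma length_unary: "length xs \<le> length (unary xs)"
  by (induction xs) (simp_all add: unary_def)

lemma unary_eq_bits: "unary (map r [0..<n]) = bits r (length (unary (map r [0..<n])))"
  by (rule nth_equalityI) (simp_all add: bits_def nth_unary)

lemma input_bit_eq: "input_bit r i = first_bit ((rest ^^ i) r)"
  unfolding input_bit_def
  using length_unary[of "map r [0..<Suc i]"] by (intro nth_unary) simp

text \<open>Nested induction, on the index outside and on the first number inside: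
  \<open>rest\<close> lowers the first number as long as it is positive and then shifts the
  index.\<close>

lemma bits_eqD:
  assumes "\<And>i. first_bit ((rest ^^ i) r) = first_bit ((rest ^^ i) r')"
  shows "r n = r' n"
  using assms
proof (induction n arbitrary: r r')
  case 0
  then show ?case
  proof (induction "r 0" arbitrary: r r')
    case 0
    from 0(2)[of 0] 0(1) show ?case by (simp add: first_bit_def)
  next
    case (Suc m)
    from Suc.prems[of 0] Suc.hyps(2) have pos: "0 < r' 0" by (simp add: first_bit_def)
    have "rest r 0 = rest r' 0"
    proof (rule Suc.hyps(1))
      show "m = rest r 0" using Suc.hyps(2) by (simp add: rest_def first_bit_def)
      show "first_bit ((rest ^^ i) (rest r)) = first_bit ((rest ^^ i) (rest r'))" for i
        using Suc.prems[of "Suc i"] by (simp add: funpow_swap1)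
    qed
    with pos Suc.hyps(2) show ?case by (simp add: rest_def first_bit_def split: if_splits)
  qed
next
  case (Suc n)
  show ?case using Suc.prems
  proof (induction "r 0" arbitrary: r r')
    case 0
    from 0(2)[of 0] 0(1) have "\<not> first_bit r" "\<not> first_bit r'" by (simp_all add: first_bit_def)
    moreover have "rest r n = rest r' n"
      using 0(2)[of "Suc i" for i] by (intro Suc.IH) (simp add: funpow_swap1)
    ultimately show ?case by (simp add: rest_def)
  next
    case (Suc m)
    from Suc.prems[of 0] Suc.hyps(2) have b: "first_bit r" "first_bit r'"
      by (simp_all add: first_bit_def)
    have "rest r (Suc n) = rest r' (Suc n)"
    proof (rule Suc.hyps(1))
      show "m = rest r 0" using Suc.hyps(2) by (simp add: rest_def first_bit_def)
      show "first_bit ((rest ^^ i) (rest r)) = first_bit ((rest ^^ i) (rest r'))" for i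
        using Suc.prems[of "Suc i"] by (simp add: funpow_swap1)
    qed
    with b show ?case by (simp add: rest_def)
  qed
qed

section \<open>Programs and the streams they write\<close>

type_synonym program = "nat \<Rightarrow> instr"

text \<open>Halting becomes a jump in place.\<close>

definition program_of :: "machine \<Rightarrow> program" where
  "program_of M n = (if n < length M then M ! n else Test 0 n n n)"

definition run :: "program \<Rightarrow> baire \<Rightarrow> config \<Rightarrow> config" where
  "run P p c = exec p (P (pc c)) c"

fun is_write :: "instr \<Rightarrow> bool" where
  "is_write (Write b l) = True"
| "is_write _ = False"

fun labels :: "instr \<Rightarrow> nat set" where
  "labels (Read i l m) = {l, m}"
| "labels (Write b l) = {l}"
| "labels (Move_Left j l) = {l}"
| "labels (Move_Right j l) = {l}"
| "labels (Put j s l) = {l}"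
| "labels (Test j l m n) = {l, m, n}"

lemma finite_labels [simp]: "finite (labels ins)"
  by (cases ins) auto

lemma pc_exec: "pc (exec p ins c) \<in> labels ins"
  by (cases ins) (auto simp: exec_def split: option.splits)

lemma written_exec: "\<not> is_write ins \<Longrightarrow> written (exec p ins c) = written c"
  by (cases ins) (auto simp: exec_def)

lemma step_eq_run: "step M p = run (program_of M) p"
  by (rule ext) (auto simp: run_def step_def program_of_def exec_def split: option.splits)

lemma produces_iff:
  "produces M p r \<longleftrightarrow>
     (\<forall>n. \<exists>t. prefix (unary (map r [0..<n])) (written ((run (program_of M) p ^^ t) init_config)))"
  by (simp add: produces_def step_eq_run)

text \<open>Inductive, because the silent stretch before the next bit must be finite;
  \<open>c'\<close> is the configuration just after the write.\<close>

inductive emits :: "program \<Rightarrow> baire \<Rightarrow> config \<Rightarrow> bool \<Rightarrow> config \<Rightarrow> bool" for P p where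
  now: "P (pc c) = Write b l \<Longrightarrow> emits P p c b (run P p c)"
| later: "\<not> is_write (P (pc c)) \<Longrightarrow> emits P p (run P p c) b c' \<Longrightarrow> emits P p c b c'"

text \<open>Coinductive, because output goes on forever; a simulation then need only be checked from
  one written bit to the next.\<close>

coinductive writes :: "program \<Rightarrow> baire \<Rightarrow> config \<Rightarrow> baire \<Rightarrow> bool" for P p where
  "emits P p c (first_bit r) c' \<Longrightarrow> writes P p c' (rest r) \<Longrightarrow> writes P p c r"

lemma written_emits: "emits P p c b c' \<Longrightarrow> written c' = written c @ [b]"
  by (induction rule: emits.induct) (auto simp: run_def exec_def[of _ "Write _ _"] written_exec)

lemma emits_reachable:
  "emits (program_of M) p c b c' \<Longrightarrow> \<exists>t. c' = (run (program_of M) p ^^ t) c"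
proof (induction rule: emits.induct)
  case (now c b l)
  show ?case by (rule exI[of _ 1]) simp
next
  case (later c b c')
  then obtain t where "c' = (run (program_of M) p ^^ t) (run (program_of M) p c)" by auto
  then have "c' = (run (program_of M) p ^^ Suc t) c" by (simp add: funpow_swap1)
  then show ?case by blast
qed

lemma writes_reachable:
  assumes "writes (program_of M) p c r"
  shows "\<exists>t. written ((run (program_of M) p ^^ t) c) = written c @ bits r n \<and>
             writes (program_of M) p ((run (program_of M) p ^^ t) c) ((rest ^^ n) r)"
proof (induction n)
  case 0
  show ?case by (rule exI[of _ 0]) (simp add: assms)
next
  case (Suc n)
  then obtain t where t: "written ((run (program_of M) p ^^ t) c) = written c @ bits r n"
    "writes (program_of M) p ((run (program_of M) p ^^ t) c) ((rest ^^ n) r)" by blast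
  from t(2) obtain c' where c': "emits (program_of M) p ((run (program_of M) p ^^ t) c) (first_bit ((rest ^^ n) r)) c'"
    "writes (program_of M) p c' (rest ((rest ^^ n) r))" by cases
  from emits_reachable[OF c'(1)] obtain t' where "c' = (run (program_of M) p ^^ (t' + t)) c"
    by (auto simp: funpow_add)
  with written_emits[OF c'(1)] c'(2) t(1) show ?case
    by (intro exI[of _ "t' + t"]) (simp add: bits_Suc)
qed

section \<open>Producing a sequence versus writing its stream\<close>

lemma produces_if_writes:
  assumes "writes (program_of M) p init_config r"
  shows "produces M p r"
  unfolding produces_iff
proof
  fix n
  obtain t where "written ((run (program_of M) p ^^ t) init_config) = bits r (length (unary (map r [0..<n])))"
    using writes_reachable[OF assms, of "length (unary (map r [0..<n]))"]
    by (auto simp: init_config_def)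
  then show "\<exists>t. prefix (unary (map r [0..<n])) (written ((run (program_of M) p ^^ t) init_config))"
    by (metis unary_eq_bits prefix_order.refl)
qed

lemma prefix_written_run: "prefix (written c) (written (run P p c))"
  by (cases "P (pc c)") (auto simp: run_def exec_def)

lemma prefix_written_funpow:
  assumes "t \<le> t'"
  shows "prefix (written ((run (program_of M) p ^^ t) c)) (written ((run (program_of M) p ^^ t') c))"
  using assms
proof (induction rule: dec_induct)
  case (step n)
  then show ?case using prefix_written_run[of "(run (program_of M) p ^^ n) c" "program_of M" p]
    by (auto intro: prefix_order.trans)
qed simp

text \<open>Output only grows, so outputs at two times are comparable; hence \<open>w t\<close> is
  comparable with the initial segment of the stream of \<open>r\<close> of the same length, and
  equal to it.\<close>

lemma written_eq_bits:
  assumes "produces M p r"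
  defines "w \<equiv> \<lambda>t. written ((run (program_of M) p ^^ t) init_config)"
  shows "w t = bits r (length (w t))"
proof -
  let ?n = "length (w t)"
  from assms(1) obtain t' where t': "prefix (unary (map r [0..<?n])) (w t')"
    unfolding produces_iff w_def by blast
  have "prefix (bits r ?n) (unary (map r [0..<?n]))"
    using length_unary[of "map r [0..<?n]"] by (subst unary_eq_bits) (simp add: prefix_bits)
  then have b: "prefix (bits r ?n) (w t')" using t' prefix_order.trans by blast
  have "prefix (w t) (w t') \<or> prefix (w t') (w t)"
    unfolding w_def using prefix_written_funpow nat_le_linear by metis
  then have "prefix (bits r ?n) (w t) \<or> prefix (w t) (bits r ?n)"
    using b prefix_order.trans prefix_same_cases by blast
  then show ?thesis by (auto simp: prefix_def) (metis append_Nil2 append_eq_append_conv length_bits)+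
qed

lemma produces_unbounded:
  assumes "produces M p r"
  shows "\<exists>t. n < length (written ((run (program_of M) p ^^ t) init_config))"
proof -
  from assms obtain t where "prefix (unary (map r [0..<Suc n])) (written ((run (program_of M) p ^^ t) init_config))"
    unfolding produces_iff by blast
  from prefix_length_le[OF this] length_unary[of "map r [0..<Suc n]"] show ?thesis
    by (intro exI[of _ t]) simp
qed

lemma emits_if_longer:
  assumes "length (written c) < length (written ((run (program_of M) p ^^ t) c))"
  shows "\<exists>b t'. emits (program_of M) p c b ((run (program_of M) p ^^ t') c)"
  using assms
proof (induction t arbitrary: c)
  case (Suc t)
  show ?case
  proof (cases "is_write (program_of M (pc c))")
    case True
    then obtain b l where "program_of M (pc c) = Write b l"
      by (cases "program_of M (pc c)") auto
    from emits.now[where P = "program_of M" and p = p, OF this] show ?thesis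
      by (intro exI[of _ b] exI[of _ 1]) simp
  next
    case False
    have "length (written (run (program_of M) p c)) < length (written ((run (program_of M) p ^^ t) (run (program_of M) p c)))"
      using Suc.prems written_exec[OF False] by (simp add: funpow_swap1 run_def[of _ _ c])
    from Suc.IH[OF this] obtain b t'
      where "emits (program_of M) p (run (program_of M) p c) b ((run (program_of M) p ^^ t') (run (program_of M) p c))" by blast
    then have "emits (program_of M) p c b ((run (program_of M) p ^^ Suc t') c)"
      using emits.later[of "program_of M" c p b] False by (simp add: funpow_swap1)
    then show ?thesis by blast
  qed
qed simp

lemma writes_if_produces:
  assumes "produces M p r"
  shows "writes (program_of M) p init_config r"
proof -
  define cfg where "cfg t = (run (program_of M) p ^^ t) init_config" for t
  \<comment> \<open>Coinduction invariant: \<open>c\<close> is reached from the start, and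
    \<open>s\<close> is what remains of \<open>r\<close> after the bits already written.\<close>
  have "\<exists>t n. c = cfg t \<and> written c = bits r n \<and> s = (rest ^^ n) r \<Longrightarrow> writes (program_of M) p c s"
    for c s
  proof (coinduction arbitrary: c s)
    case writes
    then obtain t n where c: "c = cfg t" and n: "written c = bits r n" and s: "s = (rest ^^ n) r"
      by blast
    obtain t1 where t1: "n < length (written (cfg t1))"
      using produces_unbounded[OF assms] unfolding cfg_def by blast
    have "prefix (written (cfg t1)) (written (cfg (t1 + t)))"
      unfolding cfg_def by (rule prefix_written_funpow) simp
    with t1 have "length (written c) < length (written ((run (program_of M) p ^^ t1) c))"
      using n prefix_length_le by (fastforce simp: c cfg_def funpow_add)
    then obtain b t' where e: "emits (program_of M) p c b ((run (program_of M) p ^^ t') c)"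
      using emits_if_longer by blast
    have c': "(run (program_of M) p ^^ t') c = cfg (t' + t)" by (simp add: c cfg_def funpow_add)
    have "bits r n @ [b] = bits r (Suc n)"
      using written_emits[OF e] written_eq_bits[OF assms, of "t' + t"] n c' by (simp add: cfg_def)
    then have b: "b = first_bit s" and "written (cfg (t' + t)) = bits r (Suc n)"
      using written_emits[OF e] n c' by (auto simp: bits_Suc s)
    moreover have "rest s = (rest ^^ Suc n) r" by (simp add: s)
    ultimately have "\<exists>t'' n. cfg (t' + t) = cfg t'' \<and> written (cfg (t' + t)) = bits r n \<and> rest s = (rest ^^ n) r"
      by blast
    with e show ?case unfolding c' b by blast
  qed
  moreover have "init_config = cfg 0" "written init_config = bits r 0" "r = (rest ^^ 0) r"
    by (simp_all add: cfg_def) (simp add: init_config_def)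
  ultimately show ?thesis by blast
qed

lemma produces_unique:
  assumes "produces M p r" "produces M p r'"
  shows "r = r'"
proof (rule ext)
  fix n :: nat
  show "r n = r' n"
  proof (rule bits_eqD[of r r' n])
    fix i
    obtain t where "i < length (written ((run (program_of M) p ^^ t) init_config))"
      using produces_unbounded[OF assms(1)] by blast
    then show "first_bit ((rest ^^ i) r) = first_bit ((rest ^^ i) r')"
      using written_eq_bits[OF assms(1), of t] written_eq_bits[OF assms(2), of t]
      by (metis (no_types, lifting) bits_def add_0 diff_zero length_upt nth_map nth_upt)
  qed
qed

lemma machine_fun_eq_Some_iff: "machine_fun M p = Some r \<longleftrightarrow> produces M p r"
proof -
  have "(THE r. produces M p r) = r" if "produces M p r" for r
    using that produces_unique by (intro the_equality) blast+
  then show ?thesis by (auto simp: machine_fun_def)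
qed

text \<open>A run from 0 never leaves the finite closed set \<open>S\<close>, so cutting
  \<open>P\<close> off at a bound of \<open>S\<close> gives a finite machine that writes the same.
  Combined programs can thus be defined on all of \<open>nat\<close>.\<close>

lemma computableI:
  assumes fin: "finite S" and init: "0 \<in> S" and closed: "\<And>n. n \<in> S \<Longrightarrow> labels (P n) \<subseteq> S"
    and writes: "\<And>p r. F p = Some r \<Longrightarrow> writes P p init_config r"
  shows "computable F"
proof -
  obtain N where N: "\<And>n. n \<in> S \<Longrightarrow> n < N"
    using fin by (auto simp: finite_nat_set_iff_bounded)
  define M where "M = map P [0..<N]"
  have M: "program_of M n = P n" if "n \<in> S" for n
    using N[OF that] by (simp add: program_of_def M_def)
  have S: "pc (run P p c) \<in> S" if "pc c \<in> S" for p c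
    using closed[OF that] pc_exec unfolding run_def by blast
  have emits: "emits (program_of M) p c b c' \<and> pc c' \<in> S" if "emits P p c b c'" "pc c \<in> S" for p c b c'
    using that
  proof (induction rule: emits.induct)
    case (now c b l)
    then show ?case using emits.now[of "program_of M" c b l p] S[of c p] by (simp add: M run_def)
  next
    case (later c b c')
    then show ?case using emits.later[of "program_of M" c p b c'] S[of c p] by (simp add: M run_def)
  qed
  have "writes (program_of M) p c r" if "writes P p c r" "pc c \<in> S" for p c r
    using that
  proof (coinduction arbitrary: c r)
    case writes
    from writes(1) obtain c' where "emits P p c (first_bit r) c'" "writes P p c' (rest r)" by cases
    with emits[OF this(1) writes(2)] show ?case by blast
  qed
  then have "F \<subseteq>\<^sub>m machine_fun M"
    using writes init produces_if_writes
    by (fastforce simp: map_le_def machine_fun_eq_Some_iff[symmetric] init_config_def)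
  then show ?thesis unfolding computable_def by blast
qed

text \<open>Besides 0, \<open>S\<close> collects all jump targets; one outside the list does no
  harm, because there the program only loops in place.\<close>

lemma computable_program:
  assumes "computable F"
  shows "\<exists>P S. finite S \<and> 0 \<in> S \<and> (\<forall>n\<in>S. labels (P n) \<subseteq> S) \<and>
    (\<forall>p r. F p = Some r \<longrightarrow> writes P p init_config r)"
proof -
  from assms obtain M where M: "F \<subseteq>\<^sub>m machine_fun M" unfolding computable_def by blast
  define S where "S = insert 0 (\<Union>ins\<in>set M. labels ins)"
  have "labels (program_of M n) \<subseteq> S" if "n \<in> S" for n
    using that by (auto simp: program_of_def S_def)
  moreover have "writes (program_of M) p init_config r" if "F p = Some r" for p r
    using that M by (intro writes_if_produces) (metis machine_fun_eq_Some_iff map_le_def domI)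
  moreover have "finite S" "0 \<in> S" by (auto simp: S_def)
  ultimately show ?thesis by blast
qed

section \<open>Closure properties of computable functions\<close>

text \<open>Tagging heads and tapes with \<open>k\<close> lets several programs share one
  configuration without interference, as \<open>prod_encode\<close> is injective;
  \<open>\<phi>\<close> places the labels in the combined control.\<close>

fun rename :: "nat \<Rightarrow> (nat \<Rightarrow> nat) \<Rightarrow> instr \<Rightarrow> instr" where
  "rename k \<phi> (Read i l m) = Read (prod_encode (k, i)) (\<phi> l) (\<phi> m)"
| "rename k \<phi> (Write b l) = Write b (\<phi> l)"
| "rename k \<phi> (Move_Left j l) = Move_Left (prod_encode (k, j)) (\<phi> l)"
| "rename k \<phi> (Move_Right j l) = Move_Right (prod_encode (k, j)) (\<phi> l)"
| "rename k \<phi> (Put j s l) = Put (prod_encode (k, j)) s (\<phi> l)"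
| "rename k \<phi> (Test j l m n) = Test (prod_encode (k, j)) (\<phi> l) (\<phi> m) (\<phi> n)"

text \<open>One configuration carries several others, kept apart by the number \<open>k\<close>. Program counter
  and output are not included: they are handled by the combined program.\<close>

definition component :: "nat \<Rightarrow> config \<Rightarrow> config \<Rightarrow> bool" where
  "component k c d \<longleftrightarrow> (\<forall>j. in_pos c (prod_encode (k, j)) = in_pos d j \<and>
     tape c (prod_encode (k, j)) = tape d j \<and> head_pos c (prod_encode (k, j)) = head_pos d j)"

lemma component_init: "component k init_config init_config"
  by (simp add: component_def init_config_def)

lemma component_rename:
  "component k c d \<Longrightarrow> component k (exec p (rename k \<phi> ins) c) (exec p ins d)"
  by (cases ins) (auto simp: component_def exec_def)

lemma component_other:
  "k' \<noteq> k \<Longrightarrow> component k' (exec p (rename k \<phi> ins) c) d \<longleftrightarrow> component k' c d"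
  by (cases ins) (auto simp: component_def exec_def)

lemma pc_rename:
  "component k c d \<Longrightarrow> pc (exec p (rename k \<phi> ins) c) = \<phi> (pc (exec p ins d))"
  by (cases ins) (auto simp: component_def exec_def split: option.splits)

lemma is_write_rename [simp]: "is_write (rename k \<phi> ins) = is_write ins"
  by (cases ins) auto

lemma labels_rename [simp]: "labels (rename k \<phi> ins) = \<phi> ` labels ins"
  by (cases ins) auto

lemma run_Write:
  "P (pc c) = Write b l \<Longrightarrow> run P p c = c\<lparr>pc := l, written := written c @ [b]\<rparr>"
  by (simp add: run_def exec_def)

lemma run_Read:
  "P (pc c) = Read i l m \<Longrightarrow> run P p c =
     c\<lparr>pc := (if input_bit p (in_pos c i) then m else l),
       in_pos := (in_pos c)(i := Suc (in_pos c i))\<rparr>"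
  by (simp add: run_def exec_def)

lemma component_update [simp]:
  "component k (c\<lparr>pc := l, written := w\<rparr>) d \<longleftrightarrow> component k c d"
  "component k c (d\<lparr>pc := l, written := w\<rparr>) \<longleftrightarrow> component k c d"
  by (simp_all add: component_def)

lemma component_advance:
  "component k c d \<Longrightarrow> component k
     (c\<lparr>pc := l, in_pos := (in_pos c)(prod_encode (k, i) := Suc (in_pos c (prod_encode (k, i))))\<rparr>)
     (d\<lparr>pc := l', in_pos := (in_pos d)(i := Suc (in_pos d i))\<rparr>)"
  "k' \<noteq> k \<Longrightarrow> component k'
     (c\<lparr>pc := l, in_pos := (in_pos c)(prod_encode (k, i) := x)\<rparr>) d \<longleftrightarrow> component k' c d"
  by (auto simp: component_def)

text \<open>A control state of a combined program is a compound of labels and must itself become a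
  label. The start state gets 0, where every run begins.\<close>

lemma ex_code:
  assumes "finite S" "s\<^sub>0 \<in> S"
  obtains code :: "'s \<Rightarrow> nat" and decode where
    "code s\<^sub>0 = 0" "\<And>s. s \<in> S \<Longrightarrow> decode (code s) = s"
proof -
  obtain h :: "'s \<Rightarrow> nat" where h: "inj_on h S"
    using finite_imp_inj_to_nat_seg[OF assms(1)] by blast
  define code where "code s = (if s = s\<^sub>0 then 0 else Suc (h s))" for s
  have "inj_on code S" using h by (auto simp: inj_on_def code_def)
  then show thesis by (intro that[of code "inv_into S code"]) (auto simp: code_def[of s\<^sub>0])
qed

section \<open>Pairing of computable functions\<close>

lemma first_bit_pair: "first_bit (pair a b) = first_bit a"
  by (simp add: first_bit_def pair_def)

text \<open>The pair interleaves whole numbers: its stream follows that of \<open>a\<close> until a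
  0 completes a number, and then \<open>b\<close> takes the lead.\<close>

lemma rest_pair: "rest (pair a b) = (if first_bit a then pair (rest a) b else pair b (rest a))"
proof (rule ext)
  have [simp]: "pair a b (2 * k) = a k" "pair a b (Suc (2 * k)) = b k" for a b k
    by (simp_all add: pair_def)
  show "rest (pair a b) n = (if first_bit a then pair (rest a) b else pair b (rest a)) n" for n
  proof (cases "even n")
    case True
    then obtain k where "n = 2 * k" by blast
    then show ?thesis using first_bit_pair[of a b]
      by (simp add: rest_def[of "pair a b"]) (simp add: rest_def pair_def)
  next
    case False
    then obtain k where k: "n = Suc (2 * k)" by (auto elim: oddE)
    have "pair a b (Suc n) = a (Suc k)" by (simp add: pair_def k)
    with k show ?thesis using first_bit_pair[of a b]
      by (simp add: rest_def[of "pair a b"]) (simp add: rest_def pair_def)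
  qed
qed

text \<open>The two programs run alternately, the turn passing on whenever a number is completed.\<close>

lemma computable_pairing:
  assumes "computable F" "computable G"
  shows "computable (\<lambda>p. Option.bind (F p) (\<lambda>a. map_option (pair a) (G p)))"
proof -
  obtain P0 S0 where P0: "finite S0" "0 \<in> S0" "\<And>n. n \<in> S0 \<Longrightarrow> labels (P0 n) \<subseteq> S0"
    "\<And>p r. F p = Some r \<Longrightarrow> writes P0 p init_config r"
    using computable_program[OF assms(1)] by metis
  obtain P1 S1 where P1: "finite S1" "0 \<in> S1" "\<And>n. n \<in> S1 \<Longrightarrow> labels (P1 n) \<subseteq> S1"
    "\<And>p r. G p = Some r \<Longrightarrow> writes P1 p init_config r"
    using computable_program[OF assms(2)] by metis
  \<comment> \<open>\<open>False\<close> stands for the program of \<open>F\<close> and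
    \<open>True\<close> for that of \<open>G\<close>; a control state consists of the turn and the
    current labels of both.\<close>
  define P where "P t = (if t then P1 else P0)" for t
  define S where "S t = (if t then S1 else S0)" for t
  have S: "0 \<in> S t" "labels (P t n) \<subseteq> S t" if "n \<in> S t" for t n
    using that P0(2) P1(2) P0(3)[of n] P1(3)[of n] by (simp_all add: S_def P_def split: if_splits)
  define T where "T = (UNIV :: bool set) \<times> {ls. \<forall>t. ls t \<in> S t}"
  have "finite {ls. \<forall>t :: bool. (t \<in> UNIV \<longrightarrow> ls t \<in> S0 \<union> S1) \<and> (t \<notin> UNIV \<longrightarrow> ls t = 0)}"
    by (rule finite_set_of_finite_funs) (use P0(1) P1(1) in auto)
  then have "finite {ls. \<forall>t. ls t \<in> S t}"
  proof (rule finite_subset[rotated])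
    have "ls t \<in> S0 \<union> S1" if "\<forall>t. ls t \<in> S t" for ls :: "bool \<Rightarrow> nat" and t
      using that[rule_format, of t] by (cases t) (simp_all add: S_def)
    then show "{ls. \<forall>t. ls t \<in> S t} \<subseteq>
      {ls. \<forall>t :: bool. (t \<in> UNIV \<longrightarrow> ls t \<in> S0 \<union> S1) \<and> (t \<notin> UNIV \<longrightarrow> ls t = 0)}" by blast
  qed
  then have finT: "finite T" by (simp add: T_def)
  have initT: "(False, \<lambda>_. 0) \<in> T" using P0(2) P1(2) by (simp add: T_def S_def)
  obtain code :: "bool \<times> (bool \<Rightarrow> nat) \<Rightarrow> nat" and decode where
    code: "code (False, \<lambda>_. 0) = 0" "\<And>s. s \<in> T \<Longrightarrow> decode (code s) = s"
    using ex_code[OF finT initT] by metis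
  \<comment> \<open>The new turn \<open>t = b\<close> keeps \<open>t\<close> after a 1 and flips it
    after a 0, the end of a number.\<close>
  define instr_at where "instr_at = (\<lambda>(t, ls). case P t (ls t) of
      Write b l \<Rightarrow> Write b (code (t = b, ls(t := l)))
    | _ \<Rightarrow> rename (of_bool t) (\<lambda>l. code (t, ls(t := l))) (P t (ls t)))"
  define Q where "Q n = instr_at (decode n)" for n
  define related where "related t ds c \<longleftrightarrow> pc c = code (t, \<lambda>i. pc (ds i)) \<and>
    (\<forall>i. pc (ds i) \<in> S i \<and> component (of_bool i) c (ds i))" for t ds c
  have Q: "Q (pc c) = instr_at (t, \<lambda>i. pc (ds i))" if "related t ds c" for t ds c
    using that code(2)[of "(t, \<lambda>i. pc (ds i))"] by (simp add: related_def T_def Q_def)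
  \<comment> \<open>Until program \<open>t\<close> writes, the combined program imitates it step by
    step, leaving the other component untouched.\<close>
  have sim: "\<exists>c'. emits Q p c b c' \<and> related (t = b) (ds(t := d')) c'"
    if "emits (P t) p d b d'" "d = ds t" "related t ds c" for p c b t d d' ds
    using that
  proof (induction arbitrary: ds c rule: emits.induct)
    case (now d b l)
    have w: "Q (pc c) = Write b (code (t = b, (\<lambda>i. pc (ds i))(t := l)))"
      using now by (simp add: Q instr_at_def)
    have "l \<in> S t" using now S(2)[of "pc d" t] by (auto simp: related_def)
    with now have "related (t = b) (ds(t := run (P t) p d)) (run Q p c)"
      by (auto simp: related_def run_Write[of Q, OF w] run_Write[of "P t", OF now(1)[unfolded now.prems(1)]]
               intro!: arg_cong[where f = code])
    with emits.now[of Q, OF w] show ?case by blast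
  next
    case (later d b d')
    let ?d = "run (P t) p d"
    have r: "Q (pc c) = rename (of_bool t) (\<lambda>l. code (t, (\<lambda>i. pc (ds i))(t := l))) (P t (pc d))"
      using later.prems later.hyps(1) by (auto simp: Q instr_at_def split: instr.splits)
    then have run: "run Q p c =
        exec p (rename (of_bool t) (\<lambda>l. code (t, (\<lambda>i. pc (ds i))(t := l))) (P t (pc d))) c"
        "?d = exec p (P t (pc d)) d"
      by (simp_all add: run_def)
    have d: "component (of_bool t) c d" using later.prems by (simp add: related_def)
    have "pc ?d \<in> S t"
      using later.prems S(2)[of "pc d" t] pc_exec[of p "P t (pc d)" d]
      by (auto simp: related_def run_def)
    moreover have "component (of_bool i) (run Q p c) ((ds(t := ?d)) i)" for i
    proof (cases "i = t")
      case True
      with component_rename[OF d] show ?thesis by (simp add: run)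
    next
      case False
      then have "of_bool i \<noteq> (of_bool t :: nat)" by simp
      with False later.prems show ?thesis by (simp add: run(1) component_other related_def)
    qed
    moreover have "pc (run Q p c) = code (t, \<lambda>i. pc ((ds(t := ?d)) i))"
      unfolding run pc_rename[OF d] by (rule arg_cong[where f = code]) auto
    ultimately have "related t (ds(t := ?d)) (run Q p c)"
      using later.prems by (auto simp: related_def)
    from later.IH[OF fun_upd_same[symmetric] this, unfolded fun_upd_upd] obtain c' where
      "emits Q p (run Q p c) b c'" "related (t = b) (ds(t := d')) c'" by blast
    moreover have "\<not> is_write (Q (pc c))" using later.hyps(1) by (simp add: r)
    ultimately show ?case using emits.later by blast
  qed
  \<comment> \<open>\<open>rs i\<close> is what program \<open>i\<close> still has to write; the one
    whose turn it is comes first in the pair.\<close>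
  have main: "writes Q p c r"
    if "related t ds c" "\<forall>i. writes (P i) p (ds i) (rs i)" "r = pair (rs t) (rs (\<not> t))"
    for p c r t ds rs
    using that
  proof (coinduction arbitrary: c r t ds rs)
    case writes
    from writes(2)[rule_format, of t] obtain d' where
      d': "emits (P t) p (ds t) (first_bit (rs t)) d'" "writes (P t) p d' (rest (rs t))" by cases
    from sim[OF d'(1) refl writes(1)] obtain c' where
      c': "emits Q p c (first_bit (rs t)) c'" "related (t = first_bit (rs t)) (ds(t := d')) c'"
      by blast
    let ?rs = "rs(t := rest (rs t))" and ?t = "t = first_bit (rs t)"
    have "rest r = pair (?rs ?t) (?rs (\<not> ?t))"
      by (auto simp: writes(3) rest_pair)
    moreover have "writes (P i) p ((ds(t := d')) i) (?rs i)" for i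
      using d'(2) writes(2) by simp
    ultimately have "\<exists>t ds rs. related t ds c' \<and> (\<forall>i. writes (P i) p (ds i) (rs i)) \<and>
        rest r = pair (rs t) (rs (\<not> t))"
      using c'(2) by (intro exI[of _ ?t] exI[of _ "ds(t := d')"] exI[of _ ?rs]) blast
    moreover have "emits Q p c (first_bit r) c'" using c'(1) by (simp add: writes(3) first_bit_pair)
    ultimately show ?case by blast
  qed
  show ?thesis
  proof (rule computableI[of "code ` T" Q])
    show "finite (code ` T)" using finT by simp
    show "0 \<in> code ` T" using code(1) initT by force
    show "labels (Q n) \<subseteq> code ` T" if "n \<in> code ` T" for n
    proof -
      from that obtain t ls where n: "n = code (t, ls)" "(t, ls) \<in> T" by auto
      then have "labels (P t (ls t)) \<subseteq> S t" by (intro S(2)) (simp add: T_def)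
      moreover have "(t', ls(t := l)) \<in> T" if "l \<in> S t" for t' l
        using n(2) that by (auto simp: T_def)
      ultimately show ?thesis
        by (auto simp: Q_def n code(2) instr_at_def split: instr.splits)
    qed
    show "writes Q p init_config r"
      if r: "Option.bind (F p) (\<lambda>a. map_option (pair a) (G p)) = Some r" for p r
    proof -
      from r obtain a b where ab: "F p = Some a" "G p = Some b" "r = pair a b"
        by (auto simp: Option.bind_eq_Some_conv)
      have "related False (\<lambda>_. init_config) init_config"
        using component_init P0(2) P1(2) code(1)
        by (auto simp: related_def S_def init_config_def)
      from main[OF this, of p "\<lambda>i. if i then b else a"] show ?thesis
        using ab P0(4) P1(4) by (simp add: P_def)
    qed
  qed
qed

section \<open>Composition of computable functions\<close>

text \<open>Every input head \<open>i\<close> of the outer program is served by its own copy of the inner program,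
  with component number \<open>Suc i\<close>, which is resumed until it writes the next bit. The outer
  program is component 0; a read that has no influence on the control keeps its input heads up
  to date.\<close>

lemma computable_map_comp:
  assumes "computable F" "computable G"
  shows "computable (G \<circ>\<^sub>m F)"
proof -
  obtain P1 S1 where P1: "finite S1" "0 \<in> S1" "\<And>n. n \<in> S1 \<Longrightarrow> labels (P1 n) \<subseteq> S1"
    "\<And>p r. F p = Some r \<Longrightarrow> writes P1 p init_config r"
    using computable_program[OF assms(1)] by metis
  obtain P2 S2 where P2: "finite S2" "0 \<in> S2" "\<And>n. n \<in> S2 \<Longrightarrow> labels (P2 n) \<subseteq> S2"
    "\<And>p r. G p = Some r \<Longrightarrow> writes P2 p init_config r"
    using computable_program[OF assms(2)] by metis
  \<comment> \<open>Only the finitely many input heads named in reads of the outer program need a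
    copy of the inner one; the other labels stay 0 in \<open>B\<close>, which keeps the set of
    control states finite.\<close>
  define A where "A = {i. \<exists>n\<in>S2. \<exists>l m. P2 n = Read i l m}"
  have "A \<subseteq> (\<lambda>n. case P2 n of Read i l m \<Rightarrow> i | _ \<Rightarrow> 0) ` S2"
    by (force simp: A_def)
  then have finA: "finite A" using P2(1) finite_surj by blast
  define B where "B = {ls. \<forall>i. (i \<in> A \<longrightarrow> ls i \<in> S1) \<and> (i \<notin> A \<longrightarrow> ls i = 0)}"
  define T where "T = S2 \<times> B"
  have finT: "finite T"
    unfolding T_def B_def using P1(1) P2(1) finA by (intro finite_cartesian_product finite_set_of_finite_funs)
  have initT: "(0, \<lambda>_. 0) \<in> T" using P1(2) P2(2) by (simp add: T_def B_def)
  obtain code :: "nat \<times> (nat \<Rightarrow> nat) \<Rightarrow> nat" and decode where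
    code: "code (0, \<lambda>_. 0) = 0" "\<And>s. s \<in> T \<Longrightarrow> decode (code s) = s"
    using ex_code[OF finT initT] by metis
  \<comment> \<open>At a read of head \<open>i\<close> the outer program waits at \<open>n\<close>
    while copy \<open>i\<close> runs; the bit \<open>b\<close> that the copy would write decides the
    branch instead.\<close>
  define instr_at where "instr_at = (\<lambda>(n, ls). case P2 n of
      Read i l m \<Rightarrow> (case P1 (ls i) of
          Write b l' \<Rightarrow> (let s = code (if b then m else l, ls(i := l')) in Read (prod_encode (0, i)) s s)
        | _ \<Rightarrow> rename (Suc i) (\<lambda>l'. code (n, ls(i := l'))) (P1 (ls i)))
    | _ \<Rightarrow> rename 0 (\<lambda>l. code (l, ls)) (P2 n))"
  define Q where "Q n = instr_at (decode n)" for n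
  define related where "related c2 ds c \<longleftrightarrow> pc c = code (pc c2, \<lambda>i. pc (ds i)) \<and>
    pc c2 \<in> S2 \<and> (\<lambda>i. pc (ds i)) \<in> B \<and> component 0 c c2 \<and> (\<forall>i. component (Suc i) c (ds i))"
    for c2 ds c
  have Q: "Q (pc c) = instr_at (pc c2, \<lambda>i. pc (ds i))" if "related c2 ds c" for c2 ds c
    using that code(2)[of "(pc c2, \<lambda>i. pc (ds i))"] by (simp add: related_def T_def Q_def)
  have B: "ls(i := l) \<in> B" if "ls \<in> B" "n \<in> S2" "P2 n = Read i l1 l2" "l \<in> labels (P1 (ls i))"
    for ls i l n l1 l2
    using that P1(3)[of "ls i"] by (auto simp: B_def A_def)
  \<comment> \<open>Serving one read: copy \<open>i\<close> runs up to its next bit, then the outer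
    program makes its step. That nothing is written meanwhile is expressed by letting any emission
    from \<open>c'\<close> count as one from \<open>c\<close>.\<close>
  have sim1: "\<exists>c'. related (run P2 q c2) (ds(i := d')) c' \<and>
      (\<forall>b' c''. emits Q p c' b' c'' \<longrightarrow> emits Q p c b' c'')"
    if "emits P1 p d b d'" "d = ds i" "related c2 ds c" "P2 (pc c2) = Read i l m"
      "b = input_bit q (in_pos c2 i)" for p q c c2 b ds i d d' l m
    using that
  proof (induction arbitrary: ds c rule: emits.induct)
    case (now d b l')
    let ?s = "code (if b then m else l, (\<lambda>i. pc (ds i))(i := l'))"
    have w: "Q (pc c) = Read (prod_encode (0, i)) ?s ?s"
      using now by (simp add: Q instr_at_def Let_def)
    have "(\<lambda>i. pc (ds i))(i := l') \<in> B"
      using now by (intro B) (auto simp: related_def)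
    moreover have "(if b then m else l) \<in> S2"
      using now P2(3)[of "pc c2"] by (auto simp: related_def)
    moreover have "(\<lambda>j. pc ((ds(i := run P1 p d)) j)) = (\<lambda>i. pc (ds i))(i := l')"
      using now.prems(1) run_Write[of P1, OF now(1)[unfolded now.prems(1)]] by auto
    moreover have "component (Suc j) (run Q p c) ((ds(i := run P1 p d)) j)" for j
      using now.prems
      by (simp add: related_def run_Write[of P1, OF now(1)[unfolded now.prems(1)]] run_Read[of Q, OF w] component_advance)
    moreover have "component 0 (run Q p c) (run P2 q c2)"
      using now.prems
      by (simp add: related_def run_Read[of P2, OF now.prems(3)] run_Read[of Q, OF w] component_advance)
    ultimately have "related (run P2 q c2) (ds(i := run P1 p d)) (run Q p c)"
      unfolding related_def using now.prems
      by (simp add: run_Read[of P2, OF now.prems(3)] run_Read[of Q, OF w])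
    moreover have "\<not> is_write (Q (pc c))" by (simp add: w)
    ultimately show ?case using emits.later by blast
  next
    case (later d b d')
    let ?d = "run P1 p d"
    have r: "Q (pc c) = rename (Suc i) (\<lambda>l'. code (pc c2, (\<lambda>i. pc (ds i))(i := l'))) (P1 (pc d))"
      using later.prems later.hyps(1) by (auto simp: Q instr_at_def split: instr.splits)
    then have run: "run Q p c =
        exec p (rename (Suc i) (\<lambda>l'. code (pc c2, (\<lambda>i. pc (ds i))(i := l'))) (P1 (pc d))) c"
        "?d = exec p (P1 (pc d)) d"
      by (simp_all add: run_def)
    have d: "component (Suc i) c d" using later.prems by (simp add: related_def)
    have upd: "(\<lambda>j. pc ((ds(i := ?d)) j)) = (\<lambda>i. pc (ds i))(i := pc ?d)" by auto
    have "(\<lambda>i. pc (ds i))(i := pc ?d) \<in> B"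
      using later.prems pc_exec[of p "P1 (pc d)" d] by (intro B) (auto simp: related_def run_def)
    moreover have "component (Suc j) (run Q p c) ((ds(i := ?d)) j)" for j
    proof (cases "j = i")
      case True
      with component_rename[OF d] show ?thesis by (simp add: run)
    next
      case False
      with later.prems show ?thesis by (simp add: run(1) component_other related_def)
    qed
    moreover have "component 0 (run Q p c) c2"
      using later.prems by (simp add: related_def run(1) component_other)
    moreover have "pc (run Q p c) = code (pc c2, (\<lambda>i. pc (ds i))(i := pc ?d))"
      unfolding run pc_rename[OF d] ..
    ultimately have "related c2 (ds(i := ?d)) (run Q p c)"
      unfolding related_def upd using later.prems(2) by (simp add: related_def del: fun_upd_apply)
    from later.IH[OF fun_upd_same[symmetric] this later.prems(3,4), unfolded fun_upd_upd] obtain c' where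
      "related (run P2 q c2) (ds(i := d')) c'"
      "\<And>b' c''. emits Q p c' b' c'' \<Longrightarrow> emits Q p (run Q p c) b' c''" by blast
    moreover have "\<not> is_write (Q (pc c))" using later.hyps(1) by (simp add: r)
    ultimately show ?case using emits.later by blast
  qed
  \<comment> \<open>What copy \<open>i\<close> has yet to write is the stream of \<open>q\<close>
    from the position of outer head \<open>i\<close> on, so heads at different positions are served
    independently.\<close>
  define full where "full p q c2 ds c \<longleftrightarrow> related c2 ds c \<and>
    (\<forall>i. writes P1 p (ds i) ((rest ^^ in_pos c2 i) q))" for p q c2 ds c
  have sim2: "\<exists>c' ds'. emits Q p c b c' \<and> full p q c2' ds' c'"
    if "emits P2 q c2 b c2'" "full p q c2 ds c" for p q c c2 c2' b ds
    using that
  proof (induction arbitrary: ds c rule: emits.induct)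
    case (now c2 b l)
    have w: "Q (pc c) = Write b (code (l, \<lambda>i. pc (ds i)))"
      using now Q[of c2 ds c] by (simp add: full_def instr_at_def)
    have "l \<in> S2" using now P2(3)[of "pc c2"] by (auto simp: full_def related_def)
    with now.prems have "full p q (run P2 q c2) ds (run Q p c)"
      by (simp add: full_def related_def run_Write[of Q, OF w] run_Write[of P2, OF now(1)])
    with emits.now[of Q, OF w] show ?case by blast
  next
    case (later c2 b c2')
    show ?case
    proof (cases "\<exists>i l m. P2 (pc c2) = Read i l m")
      case True
      then obtain i l m where i: "P2 (pc c2) = Read i l m" by blast
      from later.prems have "writes P1 p (ds i) ((rest ^^ in_pos c2 i) q)" by (simp add: full_def)
      then obtain d' where d': "emits P1 p (ds i) (input_bit q (in_pos c2 i)) d'"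
        "writes P1 p d' (rest ((rest ^^ in_pos c2 i) q))" by cases (simp add: input_bit_eq)
      obtain c' where c': "related (run P2 q c2) (ds(i := d')) c'"
        "\<And>b' c''. emits Q p c' b' c'' \<Longrightarrow> emits Q p c b' c''"
        using sim1[where ds = ds and i = i, OF d'(1) refl _ i refl, of c] later.prems
        unfolding full_def by blast
      have "in_pos (run P2 q c2) = (in_pos c2)(i := Suc (in_pos c2 i))"
        by (simp add: run_Read[of P2, OF i])
      with later.prems c'(1) d'(2) have "full p q (run P2 q c2) (ds(i := d')) c'"
        by (simp add: full_def)
      from later.IH[OF this] c'(2) show ?thesis by blast
    next
      case False
      let ?c2 = "run P2 q c2"
      have rel: "related c2 ds c" using later.prems by (simp add: full_def)
      have r: "Q (pc c) = rename 0 (\<lambda>l. code (l, \<lambda>i. pc (ds i))) (P2 (pc c2))"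
        using Q[OF rel] False by (auto simp: instr_at_def split: instr.splits)
      then have run: "run Q p c = exec p (rename 0 (\<lambda>l. code (l, \<lambda>i. pc (ds i))) (P2 (pc c2))) c"
        by (simp add: run_def)
      have comp: "component 0 c c2" using rel by (simp add: related_def)
      have c2: "?c2 = exec p (P2 (pc c2)) c2" "in_pos ?c2 = in_pos c2"
        using False by (cases "P2 (pc c2)"; simp add: run_def exec_def)+
      have "component 0 (run Q p c) ?c2"
        unfolding c2(1) run by (rule component_rename[OF comp])
      moreover have "component (Suc j) (run Q p c) (ds j)" for j
        using rel by (simp add: related_def run component_other)
      moreover have "pc (run Q p c) = code (pc ?c2, \<lambda>i. pc (ds i))"
        unfolding c2(1) run by (rule pc_rename[OF comp])
      moreover have "pc ?c2 \<in> S2"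
        using rel P2(3)[of "pc c2"] pc_exec[of q "P2 (pc c2)" c2] by (auto simp: related_def run_def)
      ultimately have "full p q ?c2 ds (run Q p c)"
        using later.prems by (simp add: full_def related_def c2(2))
      from later.IH[OF this] obtain c' ds' where
        "emits Q p (run Q p c) b c'" "full p q c2' ds' c'" by blast
      moreover have "\<not> is_write (Q (pc c))" using later.hyps(1) by (simp add: r)
      ultimately show ?thesis using emits.later by blast
    qed
  qed
  have main: "writes Q p c r" if "full p q c2 ds c" "writes P2 q c2 r" for p q c c2 ds r
    using that
  proof (coinduction arbitrary: c c2 ds r)
    case writes
    from writes(2) obtain c2' where
      c2': "emits P2 q c2 (first_bit r) c2'" "writes P2 q c2' (rest r)" by cases
    from sim2[OF c2'(1) writes(1)] c2'(2) show ?case by blast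
  qed
  show ?thesis
  proof (rule computableI[of "code ` T" Q])
    show "finite (code ` T)" using finT by simp
    show "0 \<in> code ` T" using code(1) initT by force
    show "labels (Q s) \<subseteq> code ` T" if "s \<in> code ` T" for s
    proof -
      from that obtain n ls where s: "s = code (n, ls)" "(n, ls) \<in> T" by auto
      show ?thesis
      proof (cases "P2 n")
        case (Read i l m)
        have "(n', ls(i := l')) \<in> T" if "l' \<in> labels (P1 (ls i))" "n' \<in> S2" for l' n'
          using B[where ls = ls and n = n and i = i, OF _ _ Read that(1)] s(2) that(2)
          by (simp add: T_def del: fun_upd_apply)
        moreover have "n \<in> S2" "l \<in> S2" "m \<in> S2" using s(2) P2(3)[of n] Read by (auto simp: T_def)
        ultimately show ?thesis
          by (auto simp: Q_def s code(2) instr_at_def Read Let_def split: instr.splits)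
      next
        case Write
        with s P2(3)[of n] show ?thesis
          by (auto simp: Q_def code(2) instr_at_def T_def)
      qed (use s P2(3)[of n] in \<open>auto simp: Q_def code(2) instr_at_def T_def\<close>)
    qed
    show "writes Q p init_config r" if r: "(G \<circ>\<^sub>m F) p = Some r" for p r
    proof -
      from r obtain q where q: "F p = Some q" "G q = Some r" by (auto simp: map_comp_Some_iff)
      have "full p q init_config (\<lambda>_. init_config) init_config"
        using component_init P1(2,4) P2(2) code(1) q(1)
        by (auto simp: full_def related_def B_def init_config_def)
      from main[OF this] P2(4)[OF q(2)] show ?thesis by blast
    qed
  qed
qed

section \<open>Computability of the projections\<close>

lemma first_bit_proj1: "first_bit (proj1 s) = first_bit s"
  by (simp add: first_bit_def proj1_def)

lemma rest_proj1: "rest (proj1 s) = (if first_bit s then proj1 (rest s) else proj2 (rest s))"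
  by (rule ext) (auto simp: rest_def first_bit_def proj1_def proj2_def)

text \<open>A skipped number yields no output, so \<open>proj2 s\<close> itself is rewritten rather
  than its rest: a 1 leaves it in the skipping phase, a 0 ends that phase.\<close>

lemma proj2_rest: "proj2 s = (if first_bit s then proj2 (rest s) else proj1 (rest s))"
  by (rule ext) (auto simp: rest_def first_bit_def proj1_def proj2_def)

text \<open>One loop serves both projections: \<open>cp\<close> copies a number and
  \<open>sk\<close> skips one, alternating at each 0. Only the starting point differs.\<close>

lemma writes_projections:
  assumes copy: "P cp = Read 0 w0 w1" "P w0 = Write False sk" "P w1 = Write True cp"
    and skip: "P sk = Read 0 cp sk"
    and "pc c = cp \<and> r = proj1 ((rest ^^ in_pos c 0) p) \<or>
         pc c = sk \<and> r = proj2 ((rest ^^ in_pos c 0) p)"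
  shows "writes P p c r"
  using assms(5)
proof (coinduction arbitrary: c r)
  case writes
  let ?inv = "\<lambda>c r. pc c = cp \<and> r = proj1 ((rest ^^ in_pos c 0) p) \<or>
         pc c = sk \<and> r = proj2 ((rest ^^ in_pos c 0) p)"
  have cp: "\<exists>c'. emits P p c (first_bit (proj1 s)) c' \<and> ?inv c' (rest (proj1 s))"
    if "pc c = cp" "s = (rest ^^ in_pos c 0) p" for c s
  proof -
    let ?d = "run P p c"
    have d: "pc ?d = (if first_bit s then w1 else w0)" "in_pos ?d 0 = Suc (in_pos c 0)"
      using that copy by (simp_all add: run_def exec_def input_bit_eq)
    then have "P (pc ?d) = Write (first_bit s) (if first_bit s then cp else sk)"
      using copy by simp
    from emits.now[of P, OF this] have "emits P p c (first_bit s) (run P p ?d)"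
      by (rule emits.later[rotated]) (simp add: that copy)
    moreover have "?inv (run P p ?d) (rest (proj1 s))"
      using that d copy by (auto simp: run_def[of _ _ ?d] exec_def rest_proj1)
    ultimately show ?thesis by (auto simp: first_bit_proj1)
  qed
  \<comment> \<open>Skipping comes to an end by induction on the number that is skipped.\<close>
  have sk: "\<exists>c'. emits P p c (first_bit (proj2 s)) c' \<and> ?inv c' (rest (proj2 s))"
    if "pc c = sk" "s = (rest ^^ in_pos c 0) p" for c s
    using that
  proof (induction "s 0" arbitrary: c s)
    case 0
    let ?d = "run P p c"
    have b: "\<not> first_bit s" using 0(1) by (simp add: first_bit_def)
    have "pc ?d = cp" "rest s = (rest ^^ in_pos ?d 0) p"
      using 0(2,3) skip b by (simp_all add: run_def exec_def input_bit_eq)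
    from cp[OF this] obtain c' where
      c': "emits P p ?d (first_bit (proj1 (rest s))) c'" "?inv c' (rest (proj1 (rest s)))" by blast
    have "emits P p c (first_bit (proj1 (rest s))) c'"
      using c'(1) by (rule emits.later[rotated]) (simp add: 0(2) skip)
    moreover have "proj2 s = proj1 (rest s)" using b by (subst proj2_rest) simp
    ultimately show ?case using c'(2) by auto
  next
    case (Suc n)
    let ?d = "run P p c"
    have b: "first_bit s" "n = rest s 0"
      using Suc.hyps(2) by (cases "s 0"; simp add: first_bit_def rest_def)+
    have "pc ?d = sk" "rest s = (rest ^^ in_pos ?d 0) p"
      using Suc.prems skip b by (simp_all add: run_def exec_def input_bit_eq)
    from Suc.hyps(1)[OF b(2) this] obtain c' where
      c': "emits P p ?d (first_bit (proj2 (rest s))) c'" "?inv c' (rest (proj2 (rest s)))" by blast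
    have "emits P p c (first_bit (proj2 (rest s))) c'"
      using c'(1) by (rule emits.later[rotated]) (simp add: Suc.prems skip)
    moreover have "proj2 s = proj2 (rest s)" using b by (subst proj2_rest) simp
    ultimately show ?case using c'(2) by auto
  qed
  have "\<exists>c'. emits P p c (first_bit r) c' \<and> ?inv c' (rest r)"
    using writes cp[of c, OF _ refl] sk[of c, OF _ refl] by (elim disjE conjE) simp_all
  then show ?case by blast
qed

lemma computable_proj1: "computable (Some \<circ> proj1)"
proof (rule computableI[of "{0, 1, 2, 3}"])
  let ?P = "\<lambda>n. [Read 0 1 2, Write False 3, Write True 0, Read 0 0 3] ! n"
  show "labels (?P n) \<subseteq> {0, 1, 2, 3}" if "n \<in> {0, 1, 2, 3}" for n
    using that by auto
  show "writes ?P p init_config r" if "(Some \<circ> proj1) p = Some r" for p r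
    by (rule writes_projections[of _ 0 1 2 3]) (use that in \<open>auto simp: init_config_def\<close>)
qed auto

lemma computable_proj2: "computable (Some \<circ> proj2)"
proof (rule computableI[of "{0, 1, 2, 3}"])
  \<comment> \<open>The loop for \<open>proj1\<close> with labels 0 and 3 exchanged, so that the
    run, which starts at 0, begins by skipping.\<close>
  let ?P = "\<lambda>n. [Read 0 3 0, Write False 0, Write True 3, Read 0 1 2] ! n"
  show "labels (?P n) \<subseteq> {0, 1, 2, 3}" if "n \<in> {0, 1, 2, 3}" for n
    using that by auto
  show "writes ?P p init_config r" if "(Some \<circ> proj2) p = Some r" for p r
    by (rule writes_projections[of _ 3 1 2 0]) (use that in \<open>auto simp: init_config_def\<close>)
qed auto

lemma computable_machine_fun: "computable (machine_fun M)"
  unfolding computable_def by (intro exI[of _ M]) simp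

lemma computable_comp:
  assumes "computable (\<lambda>p. Some (a p))" "computable (\<lambda>p. Some (b p))"
  shows "computable (\<lambda>p. Some (a (b p)))"
  using computable_map_comp[OF assms(2,1)] by (simp add: map_comp_def)

lemma computable_pair:
  assumes "computable (\<lambda>p. Some (a p))" "computable (\<lambda>p. Some (b p))"
  shows "computable (\<lambda>p. Some (pair (a p) (b p)))"
  using computable_pairing[OF assms] by simp

lemma computable_proj [simp]:
  "computable (\<lambda>p. Some (proj1 p))" "computable (\<lambda>p. Some (proj2 p))"
  using computable_proj1 computable_proj2 by (simp_all add: o_def)

lemma proj_pair [simp]: "proj1 (pair p q) = p" "proj2 (pair p q) = q"
  by (simp_all add: fun_eq_iff proj1_def proj2_def pair_def)

lemma pair_proj [simp]: "pair (proj1 p) (proj2 p) = p"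
  by (rule ext) (auto simp: pair_def proj1_def proj2_def)

lemma computable_id: "computable (\<lambda>p. Some p)"
  using computable_pair[OF computable_proj] by simp

section \<open>Reductions without realizers\<close>

text \<open>A Weihrauch reduction on the level of single names: instead of realizers,
  \<open>n\<close> ranges over all names of admissible answers to the one question asked.\<close>

definition reduction ::
    "(baire \<rightharpoonup> baire) \<Rightarrow> (baire \<rightharpoonup> baire) \<Rightarrow> ('a, 'b) mvfun \<Rightarrow> ('c, 'd) mvfun \<Rightarrow> bool" where
  "reduction K H f g \<longleftrightarrow> (\<forall>p u. source f p = Some u \<longrightarrow> u \<in> mdom (val f) \<longrightarrow>
     (\<exists>q x. H p = Some q \<and> source g q = Some x \<and> x \<in> mdom (val g) \<and>
       (\<forall>n y. target g n = Some y \<longrightarrow> y \<in> val g x \<longrightarrow>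
         (\<exists>r v. K (pair p n) = Some r \<and> target f r = Some v \<and> v \<in> val f u))))"

text \<open>A realizer can be changed at a single name, so it can be made to give any admissible
  answer there, or to be undefined where there is nothing to answer.\<close>

lemma reducible_iff:
  assumes "\<And>x. val g x \<subseteq> points (target g)"
  shows "reducible f g \<longleftrightarrow> (\<exists>K H. computable K \<and> computable H \<and> reduction K H f g)"
proof -
  have "(\<forall>G. realizes G g \<longrightarrow> realizes (K \<circ>\<^sub>m (\<lambda>p. map_option (pair p) ((G \<circ>\<^sub>m H) p))) f) \<longleftrightarrow>
      reduction K H f g" for K H
  proof
    assume *: "\<forall>G. realizes G g \<longrightarrow> realizes (K \<circ>\<^sub>m (\<lambda>p. map_option (pair p) ((G \<circ>\<^sub>m H) p))) f"
    have apply_realizer: "\<exists>q n r v. H p = Some q \<and> G q = Some n \<and> K (pair p n) = Some r \<and>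
        target f r = Some v \<and> v \<in> val f u"
      if "realizes G g" "source f p = Some u" "u \<in> mdom (val f)" for G p u
    proof -
      from *[rule_format, OF that(1)] that(2,3) obtain v where
        "(target f \<circ>\<^sub>m (K \<circ>\<^sub>m (\<lambda>p. map_option (pair p) ((G \<circ>\<^sub>m H) p)))) p = Some v" "v \<in> val f u"
        unfolding realizes_def by blast
      then show ?thesis by (auto simp: map_comp_Some_iff)
    qed
    define input where "input q \<longleftrightarrow> (\<exists>x. source g q = Some x \<and> x \<in> mdom (val g))" for q
    define answer where
      "answer q n \<longleftrightarrow> (\<exists>x y. source g q = Some x \<and> target g n = Some y \<and> y \<in> val g x)" for q n
    \<comment> \<open>The assumption on \<open>g\<close> enters here: an admissible value needs a
      name to be returned by a realizer.\<close>
    have "\<exists>n. answer q n" if "input q" for q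
      using that assms by (fastforce simp: input_def answer_def mdom_def ran_def)
    then obtain c where c: "answer q (c q)" if "input q" for q by metis
    \<comment> \<open>Undefined off the proper inputs, so that success of the composite at
      \<open>p\<close> forces \<open>H p\<close> to be one.\<close>
    define G where "G q = (if input q then Some (c q) else None)" for q
    have G: "realizes (G(q := if input q then Some n else None)) g" if "input q \<Longrightarrow> answer q n" for q n
      using that c by (fastforce simp: realizes_def G_def input_def answer_def map_comp_def)
    show "reduction K H f g"
      unfolding reduction_def
    proof (intro allI impI)
      fix p u
      assume u: "source f p = Some u" "u \<in> mdom (val f)"
      have "realizes G g" using G[of undefined "c undefined"] c by (simp add: G_def fun_upd_idem)
      from apply_realizer[OF this u] obtain q where q: "H p = Some q" "input q"
        by (auto simp: G_def split: if_splits)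
      then obtain x where x: "source g q = Some x" "x \<in> mdom (val g)" by (auto simp: input_def)
      have "\<exists>r v. K (pair p n) = Some r \<and> target f r = Some v \<and> v \<in> val f u"
        if "target g n = Some y" "y \<in> val g x" for n y
      proof -
        have "answer q n" using that x(1) by (auto simp: answer_def)
        from apply_realizer[OF G[OF this] u] q show ?thesis by auto
      qed
      with q(1) x show "\<exists>q x. H p = Some q \<and> source g q = Some x \<and> x \<in> mdom (val g) \<and>
          (\<forall>n y. target g n = Some y \<longrightarrow> y \<in> val g x \<longrightarrow>
            (\<exists>r v. K (pair p n) = Some r \<and> target f r = Some v \<and> v \<in> val f u))" by blast
    qed
  next
    assume *: "reduction K H f g"
    show "\<forall>G. realizes G g \<longrightarrow> realizes (K \<circ>\<^sub>m (\<lambda>p. map_option (pair p) ((G \<circ>\<^sub>m H) p))) f"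
      unfolding realizes_def[of _ f]
    proof (intro allI impI)
      fix G p u
      assume G: "realizes G g" and u: "source f p = Some u" "u \<in> mdom (val f)"
      from * u obtain q x where q: "H p = Some q" "source g q = Some x" "x \<in> mdom (val g)"
        and K: "\<And>n y. target g n = Some y \<Longrightarrow> y \<in> val g x \<Longrightarrow>
          \<exists>r v. K (pair p n) = Some r \<and> target f r = Some v \<and> v \<in> val f u"
        unfolding reduction_def by blast
      from G q(2,3) obtain n y where n: "G q = Some n" "target g n = Some y" "y \<in> val g x"
        unfolding realizes_def map_comp_Some_iff by blast
      from K[OF n(2,3)] q(1) n(1)
      show "\<exists>y. (target f \<circ>\<^sub>m (K \<circ>\<^sub>m (\<lambda>p. map_option (pair p) ((G \<circ>\<^sub>m H) p)))) p = Some y \<and> y \<in> val f u"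
        by (auto simp: map_comp_Some_iff)
    qed
  qed
  then show ?thesis by (simp add: reducible_def)
qed

section \<open>Names of pairs and of strongly continuous functions\<close>

lemma prod_rep_eq_Some:
  "prod_rep X Y r = Some (x, y) \<longleftrightarrow> X (proj1 r) = Some x \<and> Y (proj2 r) = Some y"
  by (auto simp: prod_rep_def split: option.splits)

text \<open>The domain clauses of the two compositions amount to sending every cylinder name
  \<open>q\<close> of \<open>x\<close> to a name; different \<open>q\<close> may lead to different
  values.\<close>

lemma Phi_mv_eq:
  "Phi_mv U X Y p x =
     {z. (\<forall>q. cyl X q = Some x \<longrightarrow> (\<exists>r. Phi U p q = Some r \<and> r \<in> dom Y)) \<and>
         (\<exists>q r. cyl X q = Some x \<and> Phi U p q = Some r \<and> Y r = Some z)}"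
proof -
  have sub: "set_option a \<noteq> {} \<longleftrightarrow> (\<exists>r. a = Some r)" for a :: "'z option" by (cases a) auto
  show ?thesis
    unfolding Phi_mv_def mcomp_def mdom_def of_map_def minverse_def sub
    by (rule set_eqI) (auto simp: subset_iff dom_def, metis+)
qed

lemma mem_mdom_Phi_mvD:
  assumes "x \<in> mdom (Phi_mv U X Y p)" "cyl X q = Some x"
  obtains r z where "Phi U p q = Some r" "Y r = Some z" "z \<in> Phi_mv U X Y p x"
  using assms by (fastforce simp: mdom_def Phi_mv_eq)

lemma mem_mdom_Phi_mvI:
  assumes "x \<in> points X" "\<And>q. cyl X q = Some x \<Longrightarrow> \<exists>r z. Phi U p q = Some r \<and> Y r = Some z"
  shows "x \<in> mdom (Phi_mv U X Y p)"
proof -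
  from assms(1) obtain q where "X q = Some x" by (auto simp: ran_def)
  \<comment> \<open>The second half of a cylinder name is arbitrary. Having one such name makes the
    value set nonempty.\<close>
  then have "cyl X (pair q q) = Some x" by (simp add: cyl_def)
  with assms(2) show ?thesis by (fastforce simp: mdom_def Phi_mv_eq)
qed

section \<open>The implication\<close>

definition mv_implication ::
    "machine \<Rightarrow> ('x, 'y) mvfun \<Rightarrow> ('u, 'v) mvfun \<Rightarrow> ('u, ('y \<Rightarrow> 'v set) \<times> 'x) mvfun" where
  "mv_implication U g f =
     \<lparr>source = source f,
      target = prod_rep (mspace U (target g) (target f)) (source g),
      val = (\<lambda>u. {(H, x). u \<in> mdom (val f) \<and> H \<in> points (mspace U (target g) (target f)) \<and>
                 x \<in> mdom (mcomp H (val g)) \<and> mcomp H (val g) x \<subseteq> val f u})\<rparr>"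

definition mv_comp_product ::
    "machine \<Rightarrow> ('u, 'v) mvfun \<Rightarrow> ('x, 'y) mvfun \<Rightarrow>
      (('y \<Rightarrow> (baire \<times> 'u) set) \<times> 'x, baire \<times> 'v) mvfun" where
  "mv_comp_product U f g =
     comp_mvfun (times_mvfun id_baire f) (transposed U (prod_rep baire_rep (source f)) g)"

lemma source_mv_comp_product:
  "source (mv_comp_product U f g) =
     prod_rep (mspace U (target g) (prod_rep baire_rep (source f))) (source g)"
  by (simp add: mv_comp_product_def comp_mvfun_def transposed_def)

lemma target_mv_comp_product:
  "target (mv_comp_product U f g) = prod_rep baire_rep (target f)"
  by (simp add: mv_comp_product_def comp_mvfun_def times_mvfun_def id_baire_def)

text \<open>The first three conjuncts unfold the domain conditions of the compositions. The program
  \<open>\<kappa>\<close> puts \<open>k\<close> into the function space, off which the transposed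
  map is empty.\<close>

lemma val_mv_comp_product:
  assumes "k = Phi_mv U (target g) (prod_rep baire_rep (source f)) \<kappa>"
  shows "(t, y) \<in> val (mv_comp_product U f g) (k, a) \<longleftrightarrow>
    a \<in> mdom (val g) \<and> val g a \<subseteq> mdom k \<and>
    (\<forall>b\<in>val g a. \<forall>t x. (t, x) \<in> k b \<longrightarrow> x \<in> mdom (val f)) \<and>
    (\<exists>b\<in>val g a. \<exists>x. (t, x) \<in> k b \<and> y \<in> val f x)"
proof -
  have "k \<in> points (mspace U (target g) (prod_rep baire_rep (source f)))"
    using assms by (auto simp: mspace_def ran_def)
  then show ?thesis
    by (auto simp: mv_comp_product_def comp_mvfun_def transposed_def times_mvfun_def id_baire_def
      mtimes_def mcomp_def mdom_def)
qed

lemma val_mv_comp_product_subset: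
  assumes "is_mvfun f"
  shows "val (mv_comp_product U f g) x \<subseteq> points (target (mv_comp_product U f g))"
proof -
  have "val (mv_comp_product U f g) x \<subseteq> UNIV \<times> points (target f)"
    using assms by (cases x) (auto simp: is_mvfun_def mv_comp_product_def comp_mvfun_def
      times_mvfun_def mtimes_def mcomp_def)
  moreover have "(t, y) \<in> points (target (mv_comp_product U f g))" if "target f q = Some y" for t q y
    by (rule ranI[where a = "pair t q"])
      (simp add: target_mv_comp_product prod_rep_eq_Some baire_rep_def that)
  ultimately show ?thesis by (fastforce simp: ran_def)
qed

lemma is_mvfun_mv_implication:
  assumes "is_mvfun f" "is_mvfun g"
  shows "is_mvfun (mv_implication U g f)"
proof -
  have "(H, x) \<in> points (prod_rep (mspace U (target g) (target f)) (source g))"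
    if "H \<in> points (mspace U (target g) (target f))" "x \<in> mdom (mcomp H (val g))" for H x
  proof -
    from that(2) have "x \<in> points (source g)"
      using assms(2) by (auto simp: is_mvfun_def mdom_def mcomp_def)
    with that(1) obtain p q where
      "mspace U (target g) (target f) p = Some H" "source g q = Some x" by (auto simp: ran_def)
    then show ?thesis by (intro ranI[where a = "pair p q"]) (simp add: prod_rep_eq_Some)
  qed
  with assms(1) show ?thesis
    by (auto simp: is_mvfun_def mv_implication_def mdom_def)
qed

text \<open>The s-m-n property; agreement is claimed only where \<open>F\<close> is defined, since a
  machine computing \<open>F\<close> may do anything elsewhere.\<close>

lemma universal_curry:
  assumes "universal U" "computable F"
  obtains s where "computable (\<lambda>p. Some (s p))"
    "\<And>p q r. F (pair p q) = Some r \<Longrightarrow> Phi U (s p) q = Some r"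
proof -
  from assms(2) obtain M where M: "F \<subseteq>\<^sub>m machine_fun M" unfolding computable_def by blast
  from assms(1) obtain s where "computable (Some \<circ> s)"
    "\<And>p q. machine_fun U (pair (s p) q) = machine_fun M (pair p q)"
    unfolding universal_def by blast
  with M that[of s] show thesis by (auto simp: Phi_def o_def map_le_def dom_def)
qed

text \<open>The witness is a constant function.\<close>

lemma mdom_mv_implication:
  assumes "universal U" "is_mvfun f" "is_mvfun g" "x \<in> mdom (val g)" "u \<in> mdom (val f)"
  shows "u \<in> mdom (val (mv_implication U g f))"
proof -
  from assms(5) obtain v where v: "v \<in> val f u" by (auto simp: mdom_def)
  with assms(2) obtain p where p: "target f p = Some v" by (fastforce simp: is_mvfun_def ran_def)
  \<comment> \<open>Currying the first projection makes \<open>s p\<close> a program for the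
    constant function with value \<open>p\<close>, a name of the solution \<open>v\<close>.\<close>
  obtain s where s: "\<And>p q r. Some (proj1 (pair p q)) = Some r \<Longrightarrow> Phi U (s p) q = Some r"
    using universal_curry[OF assms(1) computable_proj(1)] by metis
  define H where "H = Phi_mv U (target g) (target f) (s p)"
  have "y \<in> mdom H" if "y \<in> val g x" for y
    unfolding H_def
    using that assms(3) s p by (intro mem_mdom_Phi_mvI) (auto simp: is_mvfun_def)
  moreover have "H y \<subseteq> {v}" for y using s p by (auto simp: H_def Phi_mv_eq)
  ultimately have "mcomp H (val g) x \<noteq> {}" "mcomp H (val g) x \<subseteq> val f u"
    using assms(4) v by (fastforce simp: mcomp_def mdom_def)+
  moreover have "H \<in> points (mspace U (target g) (target f))"
    by (auto simp: H_def mspace_def ran_def)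
  ultimately have "(H, x) \<in> val (mv_implication U g f) u"
    using assms(5) by (simp add: mv_implication_def mdom_def)
  then show ?thesis by (auto simp: mdom_def)
qed

section \<open>Membership: reducing \<open>f\<close> to the product with the implication\<close>

lemma reducible_comp_product_implication:
  assumes U: "universal U" and f: "is_mvfun f" and g: "is_mvfun g"
    and dom: "mdom (val g) \<noteq> {} \<or> mdom (val f) = {}"
  shows "reducible f (mv_comp_product U g (mv_implication U g f))"
proof -
  let ?I = "mv_implication U g f" and ?M = "mspace U (target g) (target f)"
    and ?Z = "prod_rep baire_rep (source g)"
  have I: "source ?I = source f" "target ?I = prod_rep ?M (source g)"
    by (simp_all add: mv_implication_def)
  \<comment> \<open>Every \<open>s p\<close> is a program for the first projection. It strips the
    cylinder part from a name of \<open>(H, x)\<close>; what is left, a program for \<open>H\<close>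
    paired with a name of \<open>x\<close>, is read by \<open>?Z\<close> as that program together
    with \<open>x\<close>.\<close>
  obtain s where comp_s: "computable (\<lambda>p. Some (s p))"
    and "\<And>p q r. Some (proj1 (proj2 (pair p q))) = Some r \<Longrightarrow> Phi U (s p) q = Some r"
    using universal_curry[OF U computable_comp[OF computable_proj]] by metis
  then have s: "Phi U (s p) q = Some (proj1 q)" for p q by simp
  define H where "H p = Some (pair (s p) p)" for p
  \<comment> \<open>On \<open>pair p (pair t n)\<close>, run \<open>t\<close> on
    \<open>pair n n\<close>, a cylinder name of the answer of \<open>g\<close> named by
    \<open>n\<close>.\<close>
  define K where "K = machine_fun U \<circ>\<^sub>m
    (\<lambda>w. Some (pair (proj1 (proj2 w)) (pair (proj2 (proj2 w)) (proj2 (proj2 w)))))"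
  have "computable H"
    unfolding H_def by (intro computable_pair comp_s computable_id)
  moreover have "computable K"
    unfolding K_def
    by (intro computable_map_comp computable_machine_fun computable_pair)
      (rule computable_comp[of _ proj2]; simp)+
  moreover have "reduction K H f (mv_comp_product U g ?I)"
    unfolding reduction_def
  proof (intro allI impI)
    fix p u
    assume p: "source f p = Some u" and u: "u \<in> mdom (val f)"
    define k where "k = Phi_mv U (target ?I) ?Z (s p)"
    \<comment> \<open>\<open>H\<close> may have many programs, so \<open>t\<close> is not
      determined, but each possible \<open>t\<close> is one of them.\<close>
    have kD: "?M t = Some H \<and> x' = x" if "(t, x') \<in> k (H, x)" for t x' H x
      using that by (auto simp: k_def Phi_mv_eq s I cyl_def prod_rep_eq_Some baire_rep_def)
    have kI: "(H, x) \<in> mdom k" if "(H, x) \<in> points (target ?I)" for H x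
      unfolding k_def
    proof (rule mem_mdom_Phi_mvI[OF that])
      fix q assume "cyl (target ?I) q = Some (H, x)"
      then have "?Z (proj1 q) = Some (proj1 (proj1 q), x)"
        by (simp add: I cyl_def prod_rep_eq_Some baire_rep_def)
      then show "\<exists>r z. Phi U (s p) q = Some r \<and> ?Z r = Some z" by (simp add: s)
    qed
    have uI: "u \<in> mdom (val ?I)" using mdom_mv_implication[OF U f g _ u] dom u by blast
    have sub: "val ?I u \<subseteq> mdom k"
      using is_mvfun_mv_implication[OF f g, of U] kI by (force simp: is_mvfun_def)
    have xg: "x \<in> mdom (val g)" if "(H, x) \<in> val ?I u" for H x
      using that by (auto simp: mv_implication_def mdom_def mcomp_def)
    note C = val_mv_comp_product[OF k_def[unfolded I(2)[symmetric]]]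
    have "(k, u) \<in> mdom (val (mv_comp_product U g ?I))"
    proof -
      from uI obtain H x where Hx: "(H, x) \<in> val ?I u" by (auto simp: mdom_def)
      with sub obtain t x' where t: "(t, x') \<in> k (H, x)" by (fastforce simp: mdom_def)
      from xg[OF Hx] obtain y where "y \<in> val g x" by (auto simp: mdom_def)
      with Hx t have "(t, y) \<in> val (mv_comp_product U g ?I) (k, u)"
        unfolding C using uI sub xg kD by fastforce
      then show ?thesis by (auto simp: mdom_def)
    qed
    moreover have "source (mv_comp_product U g ?I) (pair (s p) p) = Some (k, u)"
      by (simp add: source_mv_comp_product prod_rep_eq_Some mspace_def k_def I p)
    moreover have "\<exists>r v. K (pair p n) = Some r \<and> target f r = Some v \<and> v \<in> val f u"
      if n: "target (mv_comp_product U g ?I) n = Some z" "z \<in> val (mv_comp_product U g ?I) (k, u)"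
      for n z
    proof -
      obtain t y where z: "z = (t, y)" by (cases z)
      with n(1) have ty: "t = proj1 n" "target g (proj2 n) = Some y"
        by (simp_all add: target_mv_comp_product prod_rep_eq_Some baire_rep_def)
      from n(2) obtain H x where Hx: "(H, x) \<in> val ?I u" and t: "(t, x) \<in> k (H, x)" and y: "y \<in> val g x"
        unfolding z C using kD by fastforce
      from kD[OF t] have H: "H = Phi_mv U (target g) (target f) t" by (simp add: mspace_def)
      from Hx have dom: "val g x \<subseteq> mdom H" "x \<in> mdom (val g)" "mcomp H (val g) x \<subseteq> val f u"
        by (auto simp: mv_implication_def mdom_def mcomp_def)
      with y have "y \<in> mdom (Phi_mv U (target g) (target f) t)" by (auto simp: H)
      moreover have "cyl (target g) (pair (proj2 n) (proj2 n)) = Some y" by (simp add: cyl_def ty)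
      ultimately obtain r v where
        r: "Phi U t (pair (proj2 n) (proj2 n)) = Some r" "target f r = Some v" "v \<in> H y"
        unfolding H by (rule mem_mdom_Phi_mvD)
      from r(3) y dom have "v \<in> val f u" by (auto simp: mcomp_def)
      with r(1,2) show ?thesis by (auto simp: K_def Phi_def ty(1) map_comp_def)
    qed
    ultimately show "\<exists>q x. H p = Some q \<and> source (mv_comp_product U g ?I) q = Some x \<and>
        x \<in> mdom (val (mv_comp_product U g ?I)) \<and>
        (\<forall>n y. target (mv_comp_product U g ?I) n = Some y \<longrightarrow>
          y \<in> val (mv_comp_product U g ?I) x \<longrightarrow>
          (\<exists>r v. K (pair p n) = Some r \<and> target f r = Some v \<and> v \<in> val f u))"
      unfolding H_def by blast
  qed
  ultimately show ?thesis
    using reducible_iff[OF val_mv_comp_product_subset[OF g]] by blast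
qed

section \<open>Minimality of the implication\<close>

text \<open>The reduction sends an instance of \<open>f\<close> into the domain of the product,
  where \<open>g\<close> has to answer something. This excludes the value \<open>Infty\<close> of
  the implication.\<close>

lemma reducible_comp_product_dom:
  assumes "is_mvfun f" "is_mvfun g" "reducible f (mv_comp_product U g h)" "mdom (val f) \<noteq> {}"
  shows "mdom (val g) \<noteq> {}"
proof -
  from assms(3) obtain K H where red: "reduction K H f (mv_comp_product U g h)"
    using reducible_iff[OF val_mv_comp_product_subset[OF assms(2)]] by blast
  from assms(1,4) obtain p u where "source f p = Some u" "u \<in> mdom (val f)"
    by (fastforce simp: is_mvfun_def ran_def)
  with red obtain k a where "(k, a) \<in> mdom (val (mv_comp_product U g h))"
    unfolding reduction_def by fast
  then show ?thesis
    by (fastforce simp: mdom_def mv_comp_product_def comp_mvfun_def times_mvfun_def mtimes_def mcomp_def)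
qed

lemma implication_reducible:
  assumes U: "universal U" and f: "is_mvfun f" and g: "is_mvfun g" and h: "is_mvfun h"
    and "reducible f (mv_comp_product U g h)"
  shows "reducible (mv_implication U g f) h"
proof -
  let ?I = "mv_implication U g f" and ?C = "mv_comp_product U g h"
    and ?Z = "prod_rep baire_rep (source g)"
  from assms(5) obtain K H where comp_K: "computable K" and comp_H: "computable H"
    and red: "reduction K H f ?C"
    using reducible_iff[OF val_mv_comp_product_subset[OF g]] by blast
  \<comment> \<open>\<open>F\<close> takes \<open>pair (pair p t) q'\<close> to the value of
    \<open>K\<close> at \<open>pair p (pair t (proj1 q'))\<close>; currying at
    \<open>pair p t\<close> thus gives a program acting on cylinder names.\<close>
  define F where "F = K \<circ>\<^sub>m
    (\<lambda>w. Some (pair (proj1 (proj1 w)) (pair (proj2 (proj1 w)) (proj1 (proj2 w)))))"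
  have "computable F"
    unfolding F_def
    by (intro computable_map_comp[OF _ comp_K] computable_pair)
      (rule computable_comp[of proj1 proj1] computable_comp[of proj2 proj1] computable_comp[of proj1 proj2]; simp)+
  then obtain s where comp_s: "computable (\<lambda>p. Some (s p))"
    and s: "\<And>p q r. F (pair p q) = Some r \<Longrightarrow> Phi U (s p) q = Some r"
    using universal_curry[OF U] by metis
  \<comment> \<open>On \<open>pair p n\<close>, \<open>\<kappa>\<close> extracts the program of
    \<open>k\<close> from \<open>H p\<close>, \<open>W\<close> runs it on \<open>pair n n\<close> to
    get \<open>t\<close> and a name of \<open>x\<close>, and \<open>K'\<close> returns
    \<open>s (pair p t)\<close> with that name.\<close>
  define \<kappa> where "\<kappa> = (\<lambda>q. Some (proj1 q)) \<circ>\<^sub>m (H \<circ>\<^sub>m (\<lambda>w. Some (proj1 w)))"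
  define W where "W = machine_fun U \<circ>\<^sub>m
    (\<lambda>w. Option.bind (\<kappa> w) (\<lambda>a. map_option (pair a) (Some (pair (proj2 w) (proj2 w)))))"
  define K' where "K' = (\<lambda>w. Some (pair (s (pair (proj1 (proj1 w)) (proj1 (proj2 w)))) (proj2 (proj2 w)))) \<circ>\<^sub>m
    (\<lambda>w. Option.bind (Some w) (\<lambda>a. map_option (pair a) (W w)))"
  define H' where "H' = (\<lambda>q. Some (proj2 q)) \<circ>\<^sub>m H"
  have "computable W"
    unfolding W_def \<kappa>_def
    by (intro computable_map_comp computable_pairing computable_machine_fun computable_proj
      comp_H computable_pair)
  then have "computable K'"
    unfolding K'_def
    by (intro computable_map_comp computable_pairing computable_id computable_pair
        computable_comp[OF comp_s] computable_comp[of proj1 proj1] computable_comp[of proj1 proj2]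
        computable_comp[of proj2 proj2] computable_proj)
  moreover have "computable H'"
    unfolding H'_def by (intro computable_map_comp comp_H computable_proj)
  moreover have "reduction K' H' ?I h"
    unfolding reduction_def
  proof (intro allI impI)
    fix p u
    assume p: "source ?I p = Some u" and "u \<in> mdom (val ?I)"
    then have p: "source f p = Some u" and u: "u \<in> mdom (val f)"
      by (auto simp: mv_implication_def mdom_def)
    with red obtain q ka where q: "H p = Some q" "source ?C q = Some ka" "ka \<in> mdom (val ?C)"
      and K: "\<And>n z. target ?C n = Some z \<Longrightarrow> z \<in> val ?C ka \<Longrightarrow>
        \<exists>r v. K (pair p n) = Some r \<and> target f r = Some v \<and> v \<in> val f u"
      unfolding reduction_def by blast
    obtain k a where ka: "ka = (k, a)" by (cases ka)
    with q(2) have k: "k = Phi_mv U (target h) ?Z (proj1 q)" and a: "source h (proj2 q) = Some a"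
      by (simp_all add: source_mv_comp_product prod_rep_eq_Some mspace_def)
    note C = val_mv_comp_product[OF k]
    \<comment> \<open>Any one answer of the product reveals its domain conditions, which do not
      depend on the answer.\<close>
    from q(3) obtain z where "z \<in> val ?C (k, a)" by (auto simp: ka mdom_def)
    then have dom: "a \<in> mdom (val h)" "val h a \<subseteq> mdom k"
      and kg: "\<And>b t x. b \<in> val h a \<Longrightarrow> (t, x) \<in> k b \<Longrightarrow> x \<in> mdom (val g)"
      using C[of "fst z" "snd z"] by auto
    have "\<exists>r v. K' (pair p n) = Some r \<and> target ?I r = Some v \<and> v \<in> val ?I u"
      if n: "target h n = Some b" "b \<in> val h a" for n b
    proof -
      have "b \<in> mdom (Phi_mv U (target h) ?Z (proj1 q))" using n(2) dom(2) k by auto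
      moreover have "cyl (target h) (pair n n) = Some b" by (simp add: cyl_def n(1))
      ultimately obtain w tx where w: "Phi U (proj1 q) (pair n n) = Some w"
        "?Z w = Some tx" "tx \<in> k b" unfolding k by (rule mem_mdom_Phi_mvD)
      obtain t x where tx: "tx = (t, x)" by (cases tx)
      with w(2) have t: "t = proj1 w" and x: "source g (proj2 w) = Some x"
        by (simp_all add: prod_rep_eq_Some baire_rep_def)
      have xg: "x \<in> mdom (val g)" using kg n(2) w(3) tx by blast
      define Hx where "Hx = Phi_mv U (target g) (target f) (s (pair p t))"
      \<comment> \<open>All names of all \<open>y \<in> val g x\<close> are covered: this makes
        \<open>Hx\<close> defined on the whole of \<open>val g x\<close>, with all values there
        admissible for \<open>u\<close>.\<close>
      have ans: "\<exists>r v. Phi U (s (pair p t)) q' = Some r \<and> target f r = Some v \<and> v \<in> val f u"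
        if "y \<in> val g x" "cyl (target g) q' = Some y" for y q'
      proof -
        have "(t, y) \<in> val ?C ka"
          unfolding ka C using dom kg n(2) w(3) tx that(1) by blast
        moreover have "target ?C (pair t (proj1 q')) = Some (t, y)"
          using that(2) by (simp add: target_mv_comp_product prod_rep_eq_Some baire_rep_def cyl_def)
        ultimately obtain r v where "K (pair p (pair t (proj1 q'))) = Some r"
          "target f r = Some v" "v \<in> val f u" using K by blast
        moreover from this(1) have "F (pair (pair p t) q') = Some r"
          by (simp add: F_def map_comp_def)
        ultimately show ?thesis using s by blast
      qed
      have "y \<in> mdom Hx" if "y \<in> val g x" for y
        unfolding Hx_def using ans[OF that] that g
        by (intro mem_mdom_Phi_mvI) (auto simp: is_mvfun_def, blast)
      moreover have "Hx y \<subseteq> val f u" if "y \<in> val g x" for y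
        unfolding Hx_def Phi_mv_eq using ans[OF that] by fastforce
      ultimately have "x \<in> mdom (mcomp Hx (val g))" "mcomp Hx (val g) x \<subseteq> val f u"
        using xg by (fastforce simp: mdom_def mcomp_def)+
      moreover have "Hx \<in> points (mspace U (target g) (target f))"
        by (auto simp: Hx_def mspace_def ran_def)
      ultimately have "(Hx, x) \<in> val ?I u" using u by (simp add: mv_implication_def)
      moreover have "K' (pair p n) = Some (pair (s (pair p t)) (proj2 w))"
        using w(1) q(1) t by (simp add: K'_def W_def \<kappa>_def Phi_def map_comp_def)
      moreover have "target ?I (pair (s (pair p t)) (proj2 w)) = Some (Hx, x)"
        using x by (simp add: mv_implication_def prod_rep_eq_Some mspace_def Hx_def)
      ultimately show ?thesis by blast
    qed
    moreover have "H' p = Some (proj2 q)" using q(1) by (simp add: H'_def map_comp_def)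
    ultimately show "\<exists>q x. H' p = Some q \<and> source h q = Some x \<and> x \<in> mdom (val h) \<and>
        (\<forall>n y. target h n = Some y \<longrightarrow> y \<in> val h x \<longrightarrow>
          (\<exists>r v. K' (pair p n) = Some r \<and> target ?I r = Some v \<and> v \<in> val ?I u))"
      using a dom(1) by blast
  qed
  moreover have "val h x \<subseteq> points (target h)" for x using h by (simp add: is_mvfun_def)
  ultimately show ?thesis using reducible_iff by blast
qed

text \<open>The two reductions are membership and the lower bound property, which determine a
  minimum up to equivalence.\<close>

theorem theorem3p13:
  fixes U :: machine
    and f :: "('u, 'v) mvfun"
    and g :: "('x, 'y) mvfun"
  assumes "universal U" and "is_mvfun f" and "is_mvfun g"
  shows "is_problem (implication U g f) \<and>
         MV f \<le>\<^sub>W comp_product U (MV g) (implication U g f) \<and>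
         (\<forall>h :: ('a, 'b) problem.
            is_problem h \<longrightarrow> MV f \<le>\<^sub>W comp_product U (MV g) h \<longrightarrow>
            implication U g f \<le>\<^sub>W h)"
proof (intro conjI allI impI)
  have impl: "implication U g f =
      (if mdom (val g) \<noteq> {} \<or> mdom (val f) = {} then MV (mv_implication U g f) else Infty)"
    by (simp add: implication_def mv_implication_def)
  have prod: "comp_product U (MV g) (MV h) = MV (mv_comp_product U g h)" for h :: "('c, 'd) mvfun"
    by (simp add: mv_comp_product_def)
  show "is_problem (implication U g f)"
    using is_mvfun_mv_implication[OF assms(2,3)] by (simp add: impl)
  show "MV f \<le>\<^sub>W comp_product U (MV g) (implication U g f)"
    using reducible_comp_product_implication[OF assms] by (auto simp: impl prod simp del: comp_product.simps(1))
  show "implication U g f \<le>\<^sub>W h"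
    if h: "is_problem h" "MV f \<le>\<^sub>W comp_product U (MV g) h" for h :: "('a, 'b) problem"
  proof (cases h)
    case (MV h')
    with h have "is_mvfun h'" "reducible f (mv_comp_product U g h')"
      by (simp_all add: prod del: comp_product.simps(1))
    \<comment> \<open>The domain lemma rules out that the implication is \<open>Infty\<close> while
      \<open>h\<close> is not.\<close>
    with implication_reducible[OF assms] reducible_comp_product_dom[OF assms(2,3)] MV
    show ?thesis by (auto simp: impl)
  qed (simp add: impl)
qed

end
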